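(* Let $f_1,\dots,f_r\in\mathbb C\{x,y\}$ be elements, not necessarily reduced or irreducible, let $f=f_1\cdots f_r$ and $\bar f=f/\gcd(f,\partial f/\partial y,\partial f/\partial x)$, and run the modified Newton–Puiseux algorithm (see context). Assume that the Puiseux series $s\in\mathbb C\langle\langle x\rangle\rangle$ of $\bar f$ has been separated from the rest of the series of $\bar f$ at the $i$-th step of the algorithm. Then $s$ is a Puiseux series of $f_k\in\mathbb C\{x,y\}$ with algebraic multiplicity $j\in\mathbb N$ if and only if $h^{(i)}_{j,k}\in S^{(i)}$.
   Context: Puiseux series and multiplicities. $\mathbb C\langle\langle x\rangle\rangle$ is the ring of Puiseux series (power series in some $x^{1/n}$). A Puiseux series of $g\in\mathbb C\{x,y\}$ is an $s\in\mathbb C\langle\langle x\rangle\rangle$ with zero constant term and $g(x,s(x))=0$. By the Puiseux factorization theorem, $g=u\,x^{\alpha_0}g_1^{\alpha_1}\cdots g_\ell^{\alpha_\ell}=u\,x^{\alpha_0}\prod_{i=1}^{\ell}\prod_{j=1}^{\nu_i}(y-\sigma_i^j(s_i))^{\alpha_i}$, with $u\in\mathbb C\{x,y\}$ a unit, $g_1,\dots,g_\ell\in\mathbb C\{x,y\}$ irreducible (and pairwise distinct up to units), $s_i$ a Puiseux series with $g_i(x,s_i(x))=0$, $\nu_i=\mathrm{ord}_y(g_i(0,y))$, and $\sigma_i^j$ the automorphism of $\mathbb C((x^{1/\nu_i}))$ generated by $x^{1/\nu_i}\mapsto e^{2\pi\sqrt{-1}j/\nu_i}x^{1/\nu_i}$;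 the series $\sigma_i^j(s_i)$ are the conjugates of $s_i$. The algebraic multiplicity of $s_i$ (and of its conjugates) in $g$ is $\alpha_i$. Square-free factors. The square-free factorization of $h$ is $h=h_1h_2^2\cdots h_n^n$ with $h_1,\dots,h_n$ reduced and pairwise coprime and $h_n$ a non-unit. The non-unit $h_j$ are the square-free factors of $h$ (unique up to multiplication by a unit), $h_j$ having multiplicity $j$. The modified Newton–Puiseux algorithm. The usual Newton–Puiseux algorithm is applied to $\bar f$, and the square-free factors of the $f_k$ are transformed by the same changes of variables. Put $x_0=x$, $y_0=y$, $f^{(0)}=\bar f$, $s^{(0)}=s$, and let $S^{(0)}$ be the set of all $h^{(0)}_{j,k}:=h_{j,k}\in\mathbb C\{x_0,y_0\}$, where $h_{j,k}$ is the square-free factor of $f_k$ with multiplicity $j$, for $k=1,\dots,r$. At each step, given $f^{(i)}(x_i,y_i)$ and its Puiseux series $s^{(i)}(x_i)$, the usual algorithm finds the first term $a\,x_i^{m/n}$ of $s^{(i)}$ ($a\neq 0$, with $m,n$ coprime positive integers) and performs the change of variables $x_i=x_{i+1}^{n}$, $y_i=x_{i+1}^{m}(a+y_{i+1})$. The new series $s^{(i+1)}$ is defined by $s^{(i)}(x_i)=x_{i+1}^m(a+s^{(i+1)}(x_{i+1}))$, and $f^{(i+1)}(x_{i+1},y_{i+1})$ is $f^{(i)}(x_{i+1}^n,x_{i+1}^m(a+y_{i+1}))$ divided by the largest power of $x_{i+1}$ dividing it. For $h^{(i)}_{j,k}\in S^{(i)}$ put $h^{(i+1)}_{j,k}=x_{i+1}^{-\beta}\,h^{(i)}_{j,k}(x_{i+1}^n,x_{i+1}^m(a+y_{i+1}))$,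 with $\beta=\beta_{i,j,k}$ the largest exponent such that $x_{i+1}^{\beta}$ divides the transformed series; $S^{(i+1)}$ consists of those $h^{(i+1)}_{j,k}$ that are non-units. The algorithm ends at the same step at which the usual Newton–Puiseux algorithm ends for $\bar f$. Separation. The algorithm computes partial sums of the Puiseux series; series are said to be separated when enough terms have been computed that they do not share terms from a certain degree onward. That $s$ has been separated from the rest of the series of $\bar f$ at the $i$-th step thus means that $f^{(i)}$ has no Puiseux series other than $s^{(i)}$ and its conjugates.
   Formalization: If s is already separated before any change of variables (i = 0), it is additionally assumed that x does not divide f̄; otherwise the claim fails, e.g. f_1 = y − x, f_2 = x, s = x. For i ≥ 1 nothing is added. *)

theory Defs
  imports
    "HOL-Analysis.Infinite_Sum"
    "HOL-Computational_Algebra.Computational_Algebra"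
begin

section \<open>The ring of convergent power series in two variables\<close>

text \<open>
  A formal series $\sum_{k,l} c_{k,l} x^k y^l$ is encoded as an element of $(C[[y]])[[x]]$: the outer
  variable is $x$ and \<^term>\<open>fps_nth (fps_nth F k) l\<close> is the coefficient of $x^k y^l$.  It is
  convergent if it converges absolutely at some point $(\rho,\rho)$ with $\rho > 0$, i.e. on a polydisc
  around the origin.
\<close>

definition convergent_fps2 :: "complex fps fps \<Rightarrow> bool" where
  "convergent_fps2 F \<longleftrightarrow>
     (\<exists>\<rho>::real. \<rho> > 0 \<and>
        (\<lambda>(k, l). fps_nth (fps_nth F k) l * of_real \<rho> ^ k * of_real \<rho> ^ l)
          abs_summable_on (UNIV :: (nat \<times> nat) set))"

lemma convergent_fps2_bound:
  assumes "convergent_fps2 F"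
  obtains M R where "M \<ge> 0" "R \<ge> 1" "\<And>k l. norm (fps_nth (fps_nth F k) l) \<le> M * R ^ (k + l)"
proof -
  define c where "c k l = fps_nth (fps_nth F k) l" for k l
  obtain \<rho> :: real where \<rho>: "\<rho> > 0"
    and sm: "(\<lambda>(k, l). c k l * of_real \<rho> ^ k * of_real \<rho> ^ l) abs_summable_on (UNIV :: (nat \<times> nat) set)"
    using assms unfolding convergent_fps2_def c_def by auto
  define g where "g = (\<lambda>p. norm (case p of (k, l) \<Rightarrow> c k l * of_real \<rho> ^ k * of_real \<rho> ^ l))"
  define M where "M = infsum g UNIV"
  have M0: "M \<ge> 0" unfolding M_def g_def by (intro infsum_nonneg) auto
  have "norm (c k l) \<le> M * max 1 (1 / \<rho>) ^ (k + l)" for k l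
  proof -
    have "infsum g {(k, l)} \<le> M" unfolding M_def
      by (rule infsum_mono_neutral) (use sm in \<open>auto simp: g_def\<close>)
    hence "norm (c k l) * \<rho> ^ (k + l) \<le> M"
      using \<rho> by (simp add: g_def norm_mult norm_power power_add mult_ac)
    hence "norm (c k l) \<le> M * (1 / \<rho>) ^ (k + l)"
      using \<rho> by (simp add: field_simps power_divide)
    also have "\<dots> \<le> M * max 1 (1 / \<rho>) ^ (k + l)"
      using \<rho> M0 by (intro mult_left_mono power_mono) auto
    finally show ?thesis .
  qed
  thus ?thesis using that[of M "max 1 (1 / \<rho>)"] M0 unfolding c_def by simp
qed

lemma convergent_fps2_boundI:
  assumes "R > 0" "\<And>k l. norm (fps_nth (fps_nth F k) l) \<le> M * R ^ (k + l)"
  shows "convergent_fps2 F"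
proof -
  define \<rho> where "\<rho> = 1 / (2 * R)"
  have \<rho>: "\<rho> > 0" using assms by (simp add: \<rho>_def)
  have geo: "(\<lambda>k. norm ((1/2::real) ^ k)) summable_on UNIV"
    using summable_geometric[of "1/2::real"]
    by (subst summable_on_UNIV_nonneg_real_iff) (auto simp: power_abs)
  have "(\<lambda>(k, l). (1/2::real) ^ k * (1/2) ^ l) abs_summable_on (UNIV \<times> UNIV :: (nat \<times> nat) set)"
  proof (rule iffD2[OF abs_summable_on_Sigma_iff], intro conjI ballI)
    fix k :: nat
    show "(\<lambda>l. case (k, l) of (k, l) \<Rightarrow> (1/2::real) ^ k * (1/2) ^ l) abs_summable_on UNIV"
      using summable_on_cmult_right[OF geo, of "norm ((1/2::real)^k)"] by (simp add: norm_mult)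
  next
    have "(\<lambda>k. norm (infsum (\<lambda>l. norm (case (k, l) of (k, l) \<Rightarrow> (1/2::real) ^ k * (1/2) ^ l)) UNIV))
            = (\<lambda>k. norm ((1/2::real) ^ k) * norm (infsum (\<lambda>l. norm ((1/2::real)^l)) (UNIV :: nat set)))"
      by (simp add: norm_mult infsum_cmult_right' abs_mult)
    thus "(\<lambda>k. infsum (\<lambda>l. norm (case (k, l) of (k, l) \<Rightarrow> (1/2::real) ^ k * (1/2) ^ l)) UNIV)
            abs_summable_on (UNIV :: nat set)"
      using summable_on_cmult_left[OF geo, of "norm (infsum (\<lambda>l. norm ((1/2::real)^l)) (UNIV :: nat set))"]
      by simp
  qed
  hence "(\<lambda>p. M * norm (case p of (k, l) \<Rightarrow> (1/2::real) ^ k * (1/2) ^ l))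
           summable_on (UNIV :: (nat \<times> nat) set)"
    by (intro summable_on_cmult_right) simp
  hence "(\<lambda>(k, l). fps_nth (fps_nth F k) l * of_real \<rho> ^ k * of_real \<rho> ^ l)
           abs_summable_on (UNIV :: (nat \<times> nat) set)"
  proof (rule summable_on_comparison_test)
    fix p :: "nat \<times> nat"
    obtain k l where p: "p = (k, l)" by force
    have "norm (fps_nth (fps_nth F k) l) * (\<rho> ^ k * \<rho> ^ l) \<le> M * R ^ (k + l) * (\<rho> ^ k * \<rho> ^ l)"
      using \<rho> by (intro mult_right_mono assms) auto
    also have "\<dots> = M * ((R * \<rho>) ^ k * (R * \<rho>) ^ l)"
      by (simp add: power_add power_mult_distrib mult_ac)
    also have "R * \<rho> = 1 / 2" using assms by (simp add: \<rho>_def)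
    finally show "norm (case p of (k, l) \<Rightarrow> fps_nth (fps_nth F k) l * of_real \<rho> ^ k * of_real \<rho> ^ l)
        \<le> M * norm (case p of (k, l) \<Rightarrow> (1/2::real) ^ k * (1/2) ^ l)"
      using \<rho> by (simp add: p norm_mult norm_power mult_ac)
  qed auto
  thus ?thesis using \<rho> unfolding convergent_fps2_def by blast
qed

typedef conv2 = "{F :: complex fps fps. convergent_fps2 F}"
  by (intro exI[of _ 0], simp, rule convergent_fps2_boundI[of 1 _ 0]) auto

setup_lifting type_definition_conv2

lemma convergent_fps2_const: "convergent_fps2 (fps_const (fps_const c))"
  by (rule convergent_fps2_boundI[of 1 _ "norm c"]) auto

lemma convergent_fps2_X: "convergent_fps2 fps_X"
  by (rule convergent_fps2_boundI[of 1 _ 1]) (auto simp: fps_X_def)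

lemma convergent_fps2_add:
  assumes "convergent_fps2 F" "convergent_fps2 G"
  shows "convergent_fps2 (F + G)"
proof -
  obtain M R where 1: "M \<ge> 0" "R \<ge> 1" "\<And>k l. norm (fps_nth (fps_nth F k) l) \<le> M * R ^ (k + l)"
    using convergent_fps2_bound[OF assms(1)] by blast
  obtain M' R' where 2: "M' \<ge> 0" "R' \<ge> 1" "\<And>k l. norm (fps_nth (fps_nth G k) l) \<le> M' * R' ^ (k + l)"
    using convergent_fps2_bound[OF assms(2)] by blast
  show ?thesis
  proof (rule convergent_fps2_boundI[of "max R R'" _ "M + M'"])
    fix k l
    have "norm (fps_nth (fps_nth (F + G) k) l) \<le> M * R ^ (k + l) + M' * R' ^ (k + l)"
      using norm_triangle_le[OF add_mono[OF 1(3)[of k l] 2(3)[of k l]]] by simp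
    also have "\<dots> \<le> M * max R R' ^ (k + l) + M' * max R R' ^ (k + l)"
      using 1 2 by (intro add_mono mult_left_mono power_mono) auto
    finally show "norm (fps_nth (fps_nth (F + G) k) l) \<le> (M + M') * max R R' ^ (k + l)"
      by (simp add: algebra_simps)
  qed (use 1 in auto)
qed

lemma convergent_fps2_mult:
  assumes "convergent_fps2 F" "convergent_fps2 G"
  shows "convergent_fps2 (F * G)"
proof -
  obtain M R1 where 1: "M \<ge> 0" "R1 \<ge> 1" "\<And>k l. norm (fps_nth (fps_nth F k) l) \<le> M * R1 ^ (k + l)"
    using convergent_fps2_bound[OF assms(1)] by blast
  obtain M' R2 where 2: "M' \<ge> 0" "R2 \<ge> 1" "\<And>k l. norm (fps_nth (fps_nth G k) l) \<le> M' * R2 ^ (k + l)"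
    using convergent_fps2_bound[OF assms(2)] by blast
  define R where "R = max R1 R2"
  have F: "norm (fps_nth (fps_nth F k) l) \<le> M * R ^ (k + l)" for k l
    by (rule order.trans[OF 1(3)]) (use 1 in \<open>auto intro!: mult_left_mono power_mono simp: R_def\<close>)
  have G: "norm (fps_nth (fps_nth G k) l) \<le> M' * R ^ (k + l)" for k l
    by (rule order.trans[OF 2(3)]) (use 2 in \<open>auto intro!: mult_left_mono power_mono simp: R_def\<close>)
  have R: "R \<ge> 1" using 1 by (simp add: R_def)
  show ?thesis
  proof (rule convergent_fps2_boundI[of "2 * R" _ "M * M'"])
    fix k l
    have "norm (fps_nth (fps_nth (F * G) k) l) =
            norm (\<Sum>i=0..k. \<Sum>j=0..l. fps_nth (fps_nth F i) j * fps_nth (fps_nth G (k - i)) (l - j))"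
      by (simp add: fps_mult_nth fps_sum_nth)
    also have "\<dots> \<le> (\<Sum>i=0..k. \<Sum>j=0..l. M * M' * R ^ (k + l))"
    proof (intro sum_norm_le)
      fix i j assume ij: "i \<in> {0..k}" "j \<in> {0..l}"
      have "norm (fps_nth (fps_nth F i) j * fps_nth (fps_nth G (k - i)) (l - j))
              \<le> (M * R ^ (i + j)) * (M' * R ^ ((k - i) + (l - j)))"
        unfolding norm_mult by (intro mult_mono F G) (use 1 R in auto)
      also have "\<dots> = M * M' * R ^ ((i + j) + ((k - i) + (l - j)))"
        by (simp only: power_add mult_ac)
      also have "(i + j) + ((k - i) + (l - j)) = k + l" using ij by simp
      finally show "norm (fps_nth (fps_nth F i) j * fps_nth (fps_nth G (k - i)) (l - j))
                      \<le> M * M' * R ^ (k + l)" .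
    qed
    also have "\<dots> = (real (Suc k) * real (Suc l)) * (M * M' * R ^ (k + l))" by simp
    also have "\<dots> \<le> (2 ^ k * 2 ^ l) * (M * M' * R ^ (k + l))"
    proof (intro mult_right_mono mult_mono)
      have "Suc n \<le> 2 ^ n" for n :: nat by (rule Suc_leI) simp
      hence "real (Suc n) \<le> 2 ^ n" for n by (metis of_nat_le_iff of_nat_numeral of_nat_power)
      thus "real (Suc k) \<le> 2 ^ k" "real (Suc l) \<le> 2 ^ l" by blast+
    qed (use 1 2 R in auto)
    also have "\<dots> = M * M' * (2 * R) ^ (k + l)"
      by (simp add: power_mult_distrib power_add mult_ac)
    finally show "norm (fps_nth (fps_nth (F * G) k) l) \<le> M * M' * (2 * R) ^ (k + l)" .
  qed (use R in auto)
qed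

lemma convergent_fps2_uminus: "convergent_fps2 F \<Longrightarrow> convergent_fps2 (- F)"
  unfolding convergent_fps2_def by (simp add: case_prod_unfold norm_mult)

instantiation conv2 :: idom
begin

lift_definition zero_conv2 :: conv2 is 0
  using convergent_fps2_const[of 0] by simp
lift_definition one_conv2 :: conv2 is 1
  using convergent_fps2_const[of 1] by simp
lift_definition plus_conv2 :: "conv2 \<Rightarrow> conv2 \<Rightarrow> conv2" is "(+)"
  by (rule convergent_fps2_add)
lift_definition times_conv2 :: "conv2 \<Rightarrow> conv2 \<Rightarrow> conv2" is "(*)"
  by (rule convergent_fps2_mult)
lift_definition uminus_conv2 :: "conv2 \<Rightarrow> conv2" is uminus
  by (rule convergent_fps2_uminus)
lift_definition minus_conv2 :: "conv2 \<Rightarrow> conv2 \<Rightarrow> conv2" is "(-)"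
  by (simp only: diff_conv_add_uminus convergent_fps2_add convergent_fps2_uminus)

instance
  by standard (transfer; simp add: algebra_simps)+

end

text \<open>Exact division; the value is arbitrarily $0$ when the divisor does not divide.\<close>

instantiation conv2 :: idom_divide
begin

definition divide_conv2 :: "conv2 \<Rightarrow> conv2 \<Rightarrow> conv2" where
  "divide_conv2 F G = (if G \<noteq> 0 \<and> G dvd F then THE H. F = H * G else 0)"

instance
proof
  fix F G :: conv2
  assume "G \<noteq> 0"
  thus "F * G div G = F"
    by (auto simp: divide_conv2_def intro!: the_equality)
qed (simp add: divide_conv2_def)

end

instance conv2 :: algebraic_semidom ..

lift_definition var_x :: conv2 is fps_X
  by (rule convergent_fps2_X)

lift_definition deriv_x :: "conv2 \<Rightarrow> conv2" is fps_deriv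
proof -
  fix F :: "complex fps fps" assume "convergent_fps2 F"
  then obtain M R where 1: "M \<ge> 0" "R \<ge> 1" "\<And>k l. norm (fps_nth (fps_nth F k) l) \<le> M * R ^ (k + l)"
    using convergent_fps2_bound by blast
  show "convergent_fps2 (fps_deriv F)"
  proof (rule convergent_fps2_boundI[of "2 * R" _ "M * R"])
    fix k l
    have "Suc k \<le> 2 ^ k" by (rule Suc_leI) simp
    hence "real (Suc k) \<le> 2 ^ k" by (metis of_nat_le_iff of_nat_numeral of_nat_power)
    also have "(2::real) ^ k \<le> 2 ^ (k + l)" by (intro power_increasing) auto
    finally have S: "real (Suc k) \<le> 2 ^ (k + l)" .
    have "fps_nth (fps_nth (fps_deriv F) k) l = of_nat (Suc k) * fps_nth (fps_nth F (Suc k)) l"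
      by (simp only: fps_deriv_nth Suc_eq_plus1[symmetric] fps_of_nat[symmetric] fps_mult_left_const_nth)
    hence "norm (fps_nth (fps_nth (fps_deriv F) k) l) = real (Suc k) * norm (fps_nth (fps_nth F (Suc k)) l)"
      by (simp only: norm_mult norm_of_nat)
    also have "\<dots> \<le> 2 ^ (k + l) * (M * R ^ (Suc k + l))"
      using S 1(3)[of "Suc k" l] by (intro mult_mono) auto
    finally show "norm (fps_nth (fps_nth (fps_deriv F) k) l) \<le> M * R * (2 * R) ^ (k + l)"
      by (simp add: power_mult_distrib mult_ac)
  qed (use 1 in auto)
qed

lift_definition deriv_y :: "conv2 \<Rightarrow> conv2" is "\<lambda>F. Abs_fps (\<lambda>k. fps_deriv (fps_nth F k))"
proof -
  fix F :: "complex fps fps" assume "convergent_fps2 F"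
  then obtain M R where 1: "M \<ge> 0" "R \<ge> 1" "\<And>k l. norm (fps_nth (fps_nth F k) l) \<le> M * R ^ (k + l)"
    using convergent_fps2_bound by blast
  show "convergent_fps2 (Abs_fps (\<lambda>k. fps_deriv (fps_nth F k)))"
  proof (rule convergent_fps2_boundI[of "2 * R" _ "M * R"])
    fix k l
    have "Suc l \<le> 2 ^ l" by (rule Suc_leI) simp
    hence "real (Suc l) \<le> 2 ^ l" by (metis of_nat_le_iff of_nat_numeral of_nat_power)
    also have "(2::real) ^ l \<le> 2 ^ (k + l)" by (intro power_increasing) auto
    finally have S: "real (Suc l) \<le> 2 ^ (k + l)" .
    have "norm (fps_nth (fps_deriv (fps_nth F k)) l) = real (Suc l) * norm (fps_nth (fps_nth F k) (Suc l))"
      by (simp only: fps_deriv_nth Suc_eq_plus1[symmetric] norm_mult norm_of_nat)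
    also have "\<dots> \<le> 2 ^ (k + l) * (M * R ^ (k + Suc l))"
      using S 1(3)[of k "Suc l"] by (intro mult_mono) auto
    finally show "norm (fps_nth (fps_nth (Abs_fps (\<lambda>k. fps_deriv (fps_nth F k))) k) l)
                    \<le> M * R * (2 * R) ^ (k + l)"
      by (simp add: power_mult_distrib mult_ac)
  qed (use 1 in auto)
qed

text \<open>
  \<open>fps_subst2 \<iota> F A B\<close> is $F(A,B) = \sum_{k,l} \iota(c_{k,l}) A^k B^l$ for series $A$, $B$ without
  constant term in a variable $t$.  Since $t^{k+l}$ divides $A^k B^l$, truncating the sum to
  $k,l \le N$ does not change the coefficient of $t^N$.  \<open>\<iota>\<close> embeds the coefficients of $F$ in the
  coefficient ring of $A$, $B$.
\<close>

definition fps_subst2 ::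
  "(complex \<Rightarrow> 'a::comm_ring_1) \<Rightarrow> complex fps fps \<Rightarrow> 'a fps \<Rightarrow> 'a fps \<Rightarrow> 'a fps" where
  "fps_subst2 \<iota> F A B =
     Abs_fps (\<lambda>N. \<Sum>k\<le>N. \<Sum>l\<le>N. \<iota> (fps_nth (fps_nth F k) l) * fps_nth (A ^ k * B ^ l) N)"

lemma fps_nth_power_const_add_X_bound:
  "norm (fps_nth ((fps_const (a::complex) + fps_X) ^ l) q) \<le> (1 + norm a) ^ l"
proof (induction l arbitrary: q)
  case (Suc l)
  have "fps_nth ((fps_const a + fps_X) ^ Suc l) q =
          a * fps_nth ((fps_const a + fps_X) ^ l) q +
          (if q = 0 then 0 else fps_nth ((fps_const a + fps_X) ^ l) (q - 1))"
    by (simp add: distrib_right)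
  also have "norm \<dots> \<le> norm a * (1 + norm a) ^ l + (1 + norm a) ^ l"
    using Suc.IH by (intro norm_triangle_le add_mono) (auto simp: norm_mult intro: mult_left_mono)
  finally show ?case by (simp add: algebra_simps)
qed auto

lemma fps_nth_power_const_add_X_eq_0:
  "l < q \<Longrightarrow> fps_nth ((fps_const (a::complex) + fps_X) ^ l) q = 0"
proof (induction l arbitrary: q)
  case (Suc l)
  thus ?case by (simp add: distrib_right)
qed auto

text \<open>\<open>np_subst n m a F\<close> is $F(x^n, x^m(a+y))$; the parameters are positive in all uses.\<close>

lift_definition np_subst :: "nat \<Rightarrow> nat \<Rightarrow> complex \<Rightarrow> conv2 \<Rightarrow> conv2" is
  "\<lambda>n m a F. fps_subst2 fps_const F (fps_X ^ n) (fps_X ^ m * fps_const (fps_const a + fps_X))"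
proof -
  fix n m :: nat and a :: complex and F :: "complex fps fps"
  assume "convergent_fps2 F"
  then obtain M R where 1: "M \<ge> 0" "R \<ge> 1" "\<And>k l. norm (fps_nth (fps_nth F k) l) \<le> M * R ^ (k + l)"
    using convergent_fps2_bound by blast
  define G where "G = fps_subst2 fps_const F (fps_X ^ n) (fps_X ^ m * fps_const (fps_const a + fps_X))"
  define D where "D k l N q = fps_nth (fps_nth ((fps_X ^ n) ^ k *
      (fps_X ^ m * fps_const (fps_const a + fps_X)) ^ l) N) q" for k l N q :: nat
  have D: "D k l N q = (if N = n * k + m * l then fps_nth ((fps_const a + fps_X) ^ l) q else 0)" for k l N q
  proof -
    have "(fps_X ^ n) ^ k * (fps_X ^ m * fps_const (fps_const a + fps_X)) ^ l =
            fps_X ^ (n * k + m * l) * fps_const ((fps_const a + fps_X) ^ l)"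
      by (simp add: power_mult_distrib power_mult[symmetric] power_add fps_const_power mult_ac)
    thus ?thesis
      unfolding D_def by (simp only: fps_X_power_mult_nth) auto
  qed
  have Gnth: "fps_nth (fps_nth G N) q = (\<Sum>k\<le>N. \<Sum>l\<le>N. fps_nth (fps_nth F k) l * D k l N q)" for N q
    by (simp add: G_def fps_subst2_def D_def fps_sum_nth)
  define K where "K = 4 * R ^ 2 * (1 + norm a)"
  have K: "K \<ge> 1" unfolding K_def
    using 1(2) one_le_power[OF 1(2), of 2] by (intro mult_ge1_I) auto
  have "norm (fps_nth (fps_nth G N) q) \<le> M * K ^ (N + q)" for N q
  proof (cases "q \<le> N")
    case False
    have "fps_nth (fps_nth G N) q = 0"
      using False unfolding Gnth D by (auto intro!: sum.neutral fps_nth_power_const_add_X_eq_0)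
    thus ?thesis using 1 K by simp
  next
    case True
    have "norm (fps_nth (fps_nth G N) q) \<le> (\<Sum>k\<le>N. \<Sum>l\<le>N. M * R ^ (2 * N) * (1 + norm a) ^ N)"
      unfolding Gnth
    proof (intro sum_norm_le)
      fix k l assume kl: "k \<in> {..N}" "l \<in> {..N}"
      have "norm (fps_nth (fps_nth F k) l) \<le> M * R ^ (2 * N)"
        by (rule order.trans[OF 1(3)]) (use 1 kl in \<open>auto intro!: mult_left_mono power_increasing\<close>)
      moreover have "norm (D k l N q) \<le> (1 + norm a) ^ N"
      proof -
        have "norm (fps_nth ((fps_const a + fps_X) ^ l) q) \<le> (1 + norm a) ^ N"
          by (rule order.trans[OF fps_nth_power_const_add_X_bound])
             (use kl in \<open>auto intro: power_increasing\<close>)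
        thus ?thesis by (auto simp: D)
      qed
      ultimately show "norm (fps_nth (fps_nth F k) l * D k l N q) \<le> M * R ^ (2 * N) * (1 + norm a) ^ N"
        unfolding norm_mult using 1 by (intro mult_mono) auto
    qed
    also have "\<dots> = (real (Suc N) * real (Suc N)) * (M * R ^ (2 * N) * (1 + norm a) ^ N)" by simp
    also have "\<dots> \<le> (2 ^ N * 2 ^ N) * (M * R ^ (2 * N) * (1 + norm a) ^ N)"
    proof (intro mult_right_mono mult_mono)
      have "Suc N \<le> 2 ^ N" by (rule Suc_leI) simp
      thus "real (Suc N) \<le> 2 ^ N" by (metis of_nat_le_iff of_nat_numeral of_nat_power)
      thus "real (Suc N) \<le> 2 ^ N" .
    qed (use 1 in auto)
    also have "(2::real) ^ N * 2 ^ N = 4 ^ N" by (simp add: power_mult_distrib[symmetric])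
    also have "4 ^ N * (M * R ^ (2 * N) * (1 + norm a) ^ N) = M * K ^ N"
      unfolding K_def power_mult by (simp add: power_mult_distrib mult_ac)
    also have "\<dots> \<le> M * K ^ (N + q)" using 1 K by (intro mult_left_mono power_increasing) auto
    finally show ?thesis .
  qed
  thus "convergent_fps2 (fps_subst2 fps_const F (fps_X ^ n) (fps_X ^ m * fps_const (fps_const a + fps_X)))"
    using K unfolding G_def[symmetric] by (intro convergent_fps2_boundI[of K G M]) auto
qed


section \<open>Puiseux series\<close>

text \<open>
  A Puiseux series is given by its coefficient function on exponents; \<open>puiseux_coeff s q\<close> is the
  coefficient of $x^q$.
\<close>

typedef puiseux =
  "{s :: rat \<Rightarrow> complex. \<exists>n::nat. n > 0 \<and> (\<forall>q. s q \<noteq> 0 \<longrightarrow> (\<exists>k::nat. q = of_nat k / of_nat n))}"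
  morphisms puiseux_coeff Abs_puiseux
  by (rule exI[of _ "\<lambda>_. 0"]) auto

setup_lifting type_definition_puiseux

instantiation puiseux :: zero
begin
lift_definition zero_puiseux :: puiseux is "\<lambda>_. 0" by auto
instance ..
end

definition puiseux_denom :: "nat \<Rightarrow> puiseux \<Rightarrow> bool" where
  "puiseux_denom n s \<longleftrightarrow>
     n > 0 \<and> (\<forall>q. puiseux_coeff s q \<noteq> 0 \<longrightarrow> (\<exists>k::nat. q = of_nat k / of_nat n))"

text \<open>If $s \in C[[x^{1/n}]]$, this is the power series $s(t^n)$ in $t = x^{1/n}$.\<close>

definition puiseux_pullback :: "nat \<Rightarrow> puiseux \<Rightarrow> complex fps" where
  "puiseux_pullback n s = Abs_fps (\<lambda>k. puiseux_coeff s (of_nat k / of_nat n))"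

text \<open>
  \<open>puiseux_root g s\<close>: \<open>s\<close> is a Puiseux series of \<open>g\<close>, i.e. $s$ has no constant term and
  $g(x,s(x)) = 0$.  The latter is expressed in $C[[t]]$ with $x = t^n$, for any $n$ with
  $s \in C[[x^{1/n}]]$.
\<close>

definition puiseux_root :: "conv2 \<Rightarrow> puiseux \<Rightarrow> bool" where
  "puiseux_root g s \<longleftrightarrow>
     puiseux_coeff s 0 = 0 \<and>
     (\<exists>n. puiseux_denom n s \<and>
          fps_subst2 id (Rep_conv2 g) (fps_X ^ n) (puiseux_pullback n s) = 0)"

text \<open>
  The automorphism generated by $x^{1/n} \mapsto e^{2\pi\sqrt{-1} j/n} x^{1/n}$ multiplies the
  coefficient of $x^{k/n}$ by $e^{2\pi\sqrt{-1} jk/n}$, so it depends only on $j$ and not on $n$.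
\<close>

lift_definition puiseux_conj :: "nat \<Rightarrow> puiseux \<Rightarrow> puiseux" is
  "\<lambda>j s q. cis (2 * pi * of_nat j * of_rat q) * s q"
  by auto

definition puiseux_conjugate :: "puiseux \<Rightarrow> puiseux \<Rightarrow> bool" where
  "puiseux_conjugate s t \<longleftrightarrow> (\<exists>j. t = puiseux_conj j s)"

text \<open>
  The algebraic multiplicity of \<open>s\<close> in \<open>g\<close> is \<open>\<alpha>\<close>: there is a factorization
  $g = u x^{\alpha_0} g_1^{\alpha_1} \cdots g_L^{\alpha_L}$ with $g_1,\dots,g_L$ irreducible and
  pairwise distinct up to units, each $g_i$ having a Puiseux series $s_i$, such that \<open>s\<close> is a conjugate
  of some $s_i$ and \<open>\<alpha>\<close> is the corresponding $\alpha_i$.  The relation never holds for \<open>\<alpha> = 0\<close>.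
\<close>

definition algebraic_multiplicity :: "conv2 \<Rightarrow> puiseux \<Rightarrow> nat \<Rightarrow> bool" where
  "algebraic_multiplicity g s \<alpha> \<longleftrightarrow>
     (\<exists>u \<alpha>\<^sub>0 L G A \<sigma>.
        is_unit u \<and>
        (\<forall>i\<in>{1..L::nat}. irreducible (G i) \<and> A i \<ge> 1 \<and> puiseux_root (G i) (\<sigma> i)) \<and>
        (\<forall>i\<in>{1..L}. \<forall>i'\<in>{1..L}. i \<noteq> i' \<longrightarrow> \<not> (G i dvd G i' \<and> G i' dvd G i)) \<and>
        g = u * var_x ^ \<alpha>\<^sub>0 * (\<Prod>i=1..L. G i ^ A i) \<and>
        (\<exists>i\<in>{1..L}. puiseux_conjugate (\<sigma> i) s \<and> A i = \<alpha>))"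


section \<open>Greatest common divisors and square-free factors\<close>

definition is_gcd3 :: "'a::comm_monoid_mult \<Rightarrow> 'a \<Rightarrow> 'a \<Rightarrow> 'a \<Rightarrow> bool" where
  "is_gcd3 d a b c \<longleftrightarrow>
     d dvd a \<and> d dvd b \<and> d dvd c \<and> (\<forall>e. e dvd a \<and> e dvd b \<and> e dvd c \<longrightarrow> e dvd d)"

text \<open>
  \<open>h j\<close> is the factor $h_j$.  Indices outside $1,\dots,n$ carry no square-free factor and are given the
  value 1.  A unit has no square-free factors ($n = 0$).  The existence of a square-free
  factorization implies $g \neq 0$, as $0$ is not square-free.
\<close>

definition squarefree_factorization :: "conv2 \<Rightarrow> (nat \<Rightarrow> conv2) \<Rightarrow> bool" where
  "squarefree_factorization g h \<longleftrightarrow>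
     (\<exists>n. (\<forall>j. j \<notin> {1..n} \<longrightarrow> h j = 1) \<and>
          (if n = 0 then is_unit g
           else g = (\<Prod>j=1..n. h j ^ j) \<and> \<not> is_unit (h n)) \<and>
          (\<forall>j\<in>{1..n}. squarefree (h j)) \<and>
          (\<forall>j\<in>{1..n}. \<forall>j'\<in>{1..n}. j \<noteq> j' \<longrightarrow> coprime (h j) (h j')))"


section \<open>The modified Newton--Puiseux algorithm\<close>

text \<open>
  For \<open>s \<noteq> 0\<close> the first term of \<open>s\<close> is \<open>a x\<^sup>q\<close> with \<open>q = puiseux_order s = m / n\<close> in lowest
  terms, \<open>m = np_m s\<close>, \<open>n = np_n s\<close>, \<open>a = np_a s\<close>.
\<close>

definition puiseux_order :: "puiseux \<Rightarrow> rat" where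
  "puiseux_order s = (LEAST q. puiseux_coeff s q \<noteq> 0)"

definition np_m :: "puiseux \<Rightarrow> nat" where
  "np_m s = nat (fst (quotient_of (puiseux_order s)))"

definition np_n :: "puiseux \<Rightarrow> nat" where
  "np_n s = nat (snd (quotient_of (puiseux_order s)))"

definition np_a :: "puiseux \<Rightarrow> complex" where
  "np_a s = puiseux_coeff s (puiseux_order s)"

text \<open>
  The series $s'$ without constant term defined by $s(x^n) = x^m (a + s'(x))$, see
  \<open>puiseux_coeff_np_next\<close> below.
\<close>

lift_definition np_next :: "puiseux \<Rightarrow> puiseux" is
  "\<lambda>s q. if q > 0 then puiseux_coeff s ((q + of_nat (np_m s)) / of_nat (np_n s)) else 0"
proof -
  fix s :: puiseux
  obtain N :: nat where N: "N > 0"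
    "\<And>q. puiseux_coeff s q \<noteq> 0 \<Longrightarrow> \<exists>k::nat. q = of_nat k / of_nat N"
    using puiseux_coeff[of s] by blast
  have n0: "np_n s > 0" by (simp add: np_n_def quotient_of_denom_pos')
  have "\<exists>k::nat. q = of_nat k / of_nat N"
    if q: "q > 0" "puiseux_coeff s ((q + of_nat (np_m s)) / of_nat (np_n s)) \<noteq> 0" for q
  proof -
    obtain k :: nat where "(q + of_nat (np_m s)) / of_nat (np_n s) = of_nat k / of_nat N"
      using N(2)[OF q(2)] by blast
    hence qk: "q * of_nat N = of_nat (k * np_n s) - of_nat (np_m s * N)"
      using N(1) n0 by (simp add: field_simps)
    have "q * of_nat N > 0" using q(1) N(1) by simp
    hence "(of_nat (np_m s * N) :: rat) < of_nat (k * np_n s)" using qk by simp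
    hence "np_m s * N < k * np_n s" by (simp only: of_nat_less_iff)
    hence "q * of_nat N = of_nat (k * np_n s - np_m s * N)" using qk by (simp add: of_nat_diff)
    hence "q = of_nat (k * np_n s - np_m s * N) / of_nat N" using N(1) by (simp add: field_simps)
    thus ?thesis by blast
  qed
  thus "\<exists>n::nat. n > 0 \<and> (\<forall>q. (if q > 0 then puiseux_coeff s ((q + of_nat (np_m s)) / of_nat (np_n s)) else 0) \<noteq> 0 \<longrightarrow>
          (\<exists>k::nat. q = of_nat k / of_nat n))"
    using N(1) by (intro exI[of _ N]) auto
qed

lemma puiseux_order:
  assumes "s \<noteq> 0"
  shows "puiseux_coeff s (puiseux_order s) \<noteq> 0"
    and "puiseux_coeff s q \<noteq> 0 \<Longrightarrow> puiseux_order s \<le> q"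
proof -
  obtain N :: nat where N: "N > 0"
    "\<And>q. puiseux_coeff s q \<noteq> 0 \<Longrightarrow> \<exists>k::nat. q = of_nat k / of_nat N"
    using puiseux_coeff[of s] by blast
  obtain q0 where "puiseux_coeff s q0 \<noteq> 0"
    using assms by (auto simp: puiseux_coeff_inject[symmetric] zero_puiseux.rep_eq)
  hence ex: "\<exists>k::nat. puiseux_coeff s (of_nat k / of_nat N) \<noteq> 0" using N(2) by metis
  define k where "k = (LEAST k::nat. puiseux_coeff s (of_nat k / of_nat N) \<noteq> 0)"
  have k: "puiseux_coeff s (of_nat k / of_nat N) \<noteq> 0" unfolding k_def by (rule LeastI_ex[OF ex])
  have min: "of_nat k / of_nat N \<le> q" if q: "puiseux_coeff s q \<noteq> 0" for q
  proof -
    obtain k' :: nat where k': "q = of_nat k' / of_nat N" using N(2)[OF q] by blast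
    hence "k \<le> k'" unfolding k_def using q by (intro Least_le) simp
    thus ?thesis using N(1) by (simp add: k' divide_right_mono)
  qed
  have ord: "puiseux_order s = of_nat k / of_nat N"
    unfolding puiseux_order_def by (rule Least_equality) (use k min in auto)
  show "puiseux_coeff s (puiseux_order s) \<noteq> 0" using k ord by simp
  show "puiseux_coeff s q \<noteq> 0 \<Longrightarrow> puiseux_order s \<le> q" using min ord by simp
qed

lemma puiseux_order_eq:
  assumes "s \<noteq> 0" "puiseux_coeff s 0 = 0"
  shows "puiseux_order s = of_nat (np_m s) / of_nat (np_n s)"
    and "coprime (np_m s) (np_n s)" "np_m s > 0" "np_n s > 0"
proof -
  have "puiseux_order s \<ge> 0"
    using puiseux_order(1)[OF assms(1)] puiseux_coeff[of s] by fastforce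
  moreover have "puiseux_order s \<noteq> 0" using puiseux_order(1)[OF assms(1)] assms(2) by metis
  ultimately have pos: "puiseux_order s > 0" by simp
  obtain m n where mn: "quotient_of (puiseux_order s) = (m, n)" by force
  have n: "n > 0" and eq: "puiseux_order s = of_int m / of_int n" and cop: "coprime m n"
    using quotient_of_denom_pos[OF mn] quotient_of_div[OF mn] quotient_of_coprime[OF mn] by auto
  have m: "m > 0" using pos n unfolding eq by (simp add: zero_less_divide_iff)
  show "np_m s > 0" "np_n s > 0" using m n by (auto simp: np_m_def np_n_def mn)
  show "puiseux_order s = of_nat (np_m s) / of_nat (np_n s)"
  proof -
    have "of_nat (np_m s) = (of_int m :: rat)" "of_nat (np_n s) = (of_int n :: rat)"
      using m n by (simp_all add: np_m_def np_n_def mn)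
    thus ?thesis by (simp only: eq)
  qed
  show "coprime (np_m s) (np_n s)"
    using cop m n by (simp add: np_m_def np_n_def mn coprime_nat_abs_left_iff flip: coprime_int_iff)
qed

lemma puiseux_coeff_np_next:
  assumes "s \<noteq> 0" "puiseux_coeff s 0 = 0"
  shows "puiseux_coeff (np_next s) 0 = 0"
    and "puiseux_coeff s (q / of_nat (np_n s)) =
           (if q < of_nat (np_m s) then 0
            else if q = of_nat (np_m s) then np_a s
            else puiseux_coeff (np_next s) (q - of_nat (np_m s)))"
proof -
  note * = puiseux_order_eq[OF assms]
  show "puiseux_coeff (np_next s) 0 = 0" by (simp add: np_next.rep_eq)
  have "puiseux_coeff s (q / of_nat (np_n s)) = 0" if "q < of_nat (np_m s)"
  proof (rule ccontr)
    assume "puiseux_coeff s (q / of_nat (np_n s)) \<noteq> 0"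
    hence "puiseux_order s \<le> q / of_nat (np_n s)" by (rule puiseux_order(2)[OF assms(1)])
    thus False using that *(4) by (simp add: *(1) divide_le_cancel)
  qed
  thus "puiseux_coeff s (q / of_nat (np_n s)) =
           (if q < of_nat (np_m s) then 0
            else if q = of_nat (np_m s) then np_a s
            else puiseux_coeff (np_next s) (q - of_nat (np_m s)))"
    by (auto simp: np_next.rep_eq np_a_def *(1))
qed

text \<open>
  The change of variables dictated by the first term of \<open>s\<close>, followed by division by the largest
  possible power of $x$.
\<close>

definition np_transform :: "puiseux \<Rightarrow> conv2 \<Rightarrow> conv2" where
  "np_transform s F =
     (let F' = np_subst (np_n s) (np_m s) (np_a s) F
      in F' div var_x ^ (GREATEST \<beta>. var_x ^ \<beta> dvd F'))"

text \<open>$s^{(i)}$\<close>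

primrec np_series :: "puiseux \<Rightarrow> nat \<Rightarrow> puiseux" where
  "np_series s 0 = s"
| "np_series s (Suc i) = np_next (np_series s i)"

text \<open>
  \<open>np_iter s F i\<close> is $F^{(i)}$; it is used both for $\bar f$ and for the $h_{j,k}$.  It is only
  meaningful as long as $s^{(0)}, \dots, s^{(i-1)}$ are nonzero.
\<close>

primrec np_iter :: "puiseux \<Rightarrow> conv2 \<Rightarrow> nat \<Rightarrow> conv2" where
  "np_iter s F 0 = F"
| "np_iter s F (Suc i) = np_transform (np_series s i) (np_iter s F i)"

text \<open>
  $S^{(i)}$, where \<open>h j k\<close> is the square-free factor of $f_k$ of multiplicity \<open>j\<close> for
  $k = 1,\dots,r$.
\<close>

primrec np_set :: "puiseux \<Rightarrow> nat \<Rightarrow> (nat \<Rightarrow> nat \<Rightarrow> conv2) \<Rightarrow> nat \<Rightarrow> conv2 set" where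
  "np_set s r h 0 = {h j k | j k. k \<in> {1..r} \<and> \<not> is_unit (h j k)}"
| "np_set s r h (Suc i) =
     {np_transform (np_series s i) H | H.
        H \<in> np_set s r h i \<and> \<not> is_unit (np_transform (np_series s i) H)}"

text \<open>
  \<open>s\<close> has been separated from the other series of \<open>F\<close> at the \<open>i\<close>-th step: steps $1,\dots,i$ of the
  algorithm can be carried out (each needs a first term of the current series), and $F^{(i)}$ has no
  Puiseux series other than $s^{(i)}$ and its conjugates.
\<close>

definition np_separated :: "conv2 \<Rightarrow> puiseux \<Rightarrow> nat \<Rightarrow> bool" where
  "np_separated F s i \<longleftrightarrow>
     (\<forall>t<i. np_series s t \<noteq> 0) \<and>
     (\<forall>t. puiseux_root (np_iter s F i) t \<longrightarrow> puiseux_conjugate (np_series s i) t)"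

end

theory Submission
  imports Defs
begin

text \<open>
  Fix the series $s$.  The elements of $C\{x,y\}$ that vanish at $y = s(x)$ form a prime ideal, and this
  ideal is generated by a single prime $P$ (\<open>puiseux_prime_exists\<close>): take an element of the ideal whose
  order in $y$ at $x = 0$ is minimal; Weierstrass division by it leaves a remainder of smaller degree in
  $y$, which must be $0$.  Hence \<open>s\<close> is a series of $g$ iff $P \mid g$, and the algebraic multiplicity of
  \<open>s\<close> in $g$ is the exponent of $P$ in $g$ (\<open>algebraic_multiplicity_iff_exact_power\<close>).  In a square-free
  factorization $g = h_1 h_2^2 \cdots h_n^n$ the prime $P$ divides at most one $h_j$, and that one only once;
  so the multiplicity is $j$ iff \<open>s\<close> is a series of $h_j$
  (\<open>algebraic_multiplicity_iff_root_squarefree_factor\<close>).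

  It remains to compare the series of $h = h_{j,k}$ with the units among the transforms.  The change of
  variables is compatible with evaluation: every series $t$ of $h^{(i)}$ comes from a series $T$ of $h$, with
  the same $T$ for all $h$ (\<open>puiseux_root_np_iter_lift\<close>), and $T = s$ for $t = s^{(i)}$
  (\<open>puiseux_root_np_series\<close>).  If \<open>s\<close> is a series of $h$, then $h^{(i)}$ vanishes on $s^{(i)}$ and is not a
  unit.  Conversely, a non-unit $h^{(i)}$ is not divisible by $x$, so by the Newton--Puiseux theorem it has
  some series $t$.  The lift $T$ is a series of $h$, hence of $f$, hence of $\bar f$, because dividing $f$ by
  a common divisor of $f$ and $\partial f/\partial y$ loses no series in characteristic $0$
  (\<open>puiseux_root_div_common_divisor\<close>).  So $t$ is a series of $\bar f^{(i)}$, by separation it is conjugate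
  to $s^{(i)}$, and then $s^{(i)}$ is a series of $h^{(i)}$ and \<open>s\<close> one of $h$.

  Two classical results carry this.  Weierstrass division (\<open>weierstrass_division\<close>) solves for the quotient
  one power of $x$ at a time; convergence follows from an explicit geometric bound on its coefficients.
  The Newton--Puiseux theorem (\<open>newton_puiseux\<close>) is proved by induction on the order in $y$: after
  Weierstrass preparation and the removal of the second highest coefficient in $y$, one step of the Newton
  polygon strictly lowers the order.  Only formal series are required there.
\<close>

section \<open>Substitution as a ring homomorphism\<close>

lemma fps_nth_mult_power_eq_0:
  fixes A B :: "'a::comm_ring_1 fps"
  assumes "fps_nth A 0 = 0" "fps_nth B 0 = 0" "N < k + l"
  shows "fps_nth (A ^ k * B ^ l) N = 0"
proof -
  have "fps_nth (A ^ k) i * fps_nth (B ^ l) (N - i) = 0" if "i \<le> N" for i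
    using startsby_zero_power_prefix[OF assms(1), of k] startsby_zero_power_prefix[OF assms(2), of l]
      assms(3) that by (cases "i < k") auto
  thus ?thesis by (simp add: fps_mult_nth)
qed

text \<open>
  Any bound $M \ge N$ may be used to truncate the defining sum of the coefficient of $t^N$; products
  need this freedom.
\<close>

lemma fps_subst2_nth:
  assumes "fps_nth A 0 = 0" "fps_nth B 0 = 0" "N \<le> M"
  shows "fps_nth (fps_subst2 \<iota> F A B) N =
           (\<Sum>k\<le>M. \<Sum>l\<le>M. \<iota> (fps_nth (fps_nth F k) l) * fps_nth (A ^ k * B ^ l) N)"
proof -
  have "(\<Sum>k\<le>M. \<Sum>l\<le>M. \<iota> (fps_nth (fps_nth F k) l) * fps_nth (A ^ k * B ^ l) N) =
        (\<Sum>k\<le>N. \<Sum>l\<le>M. \<iota> (fps_nth (fps_nth F k) l) * fps_nth (A ^ k * B ^ l) N)"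
    using assms by (intro sum.mono_neutral_right) (auto simp: fps_nth_mult_power_eq_0)
  also have "\<dots> = (\<Sum>k\<le>N. \<Sum>l\<le>N. \<iota> (fps_nth (fps_nth F k) l) * fps_nth (A ^ k * B ^ l) N)"
    using assms by (intro sum.cong refl sum.mono_neutral_right) (auto simp: fps_nth_mult_power_eq_0)
  finally show ?thesis by (simp add: fps_subst2_def)
qed

lemma sum_square_reindex:
  fixes g :: "nat \<Rightarrow> nat \<Rightarrow> 'a::comm_monoid_add"
  assumes "\<And>i j. N < i + j \<Longrightarrow> g i j = 0"
  shows "(\<Sum>i\<le>N. \<Sum>j\<le>N. g i j) = (\<Sum>k\<le>N. \<Sum>i\<le>k. g i (k - i))"
proof -
  have "(\<Sum>i\<le>N. \<Sum>j\<le>N. g i j) = (\<Sum>(i, j)\<in>{..N} \<times> {..N}. g i j)"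
    by (simp add: sum.cartesian_product)
  also have "\<dots> = (\<Sum>(i, j)\<in>{(i, j). i + j \<le> N}. g i j)"
    by (rule sum.mono_neutral_right) (auto intro: assms)
  also have "\<dots> = (\<Sum>k\<le>N. \<Sum>i\<le>k. g i (k - i))"
    by (rule sum.triangle_reindex_eq)
  finally show ?thesis .
qed

text \<open>
  The two embeddings that occur are the identity of $C$ (evaluation in $C[[t]]$) and $C \to C[[y]]$ (changes
  of variables).
\<close>

locale coeff_embedding =
  fixes \<iota> :: "complex \<Rightarrow> 'a::comm_ring_1"
  assumes one: "\<iota> 1 = 1" and add: "\<iota> (a + b) = \<iota> a + \<iota> b" and mult: "\<iota> (a * b) = \<iota> a * \<iota> b"
begin

lemma zero: "\<iota> 0 = 0"
  using add[of 0 0] by simp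

lemma sum: "\<iota> (\<Sum>x\<in>S. g x) = (\<Sum>x\<in>S. \<iota> (g x))"
  by (induction S rule: infinite_finite_induct) (simp_all add: zero add)

lemma subst2_add: "fps_subst2 \<iota> (F + G) A B = fps_subst2 \<iota> F A B + fps_subst2 \<iota> G A B"
  by (simp add: fps_eq_iff fps_subst2_def add distrib_right sum.distrib)

lemma subst2_sum: "fps_subst2 \<iota> (\<Sum>x\<in>S. g x) A B = (\<Sum>x\<in>S. fps_subst2 \<iota> (g x) A B)"
proof -
  have "fps_subst2 \<iota> 0 A B = 0" by (simp add: fps_eq_iff fps_subst2_def zero)
  thus ?thesis by (induction S rule: infinite_finite_induct) (simp_all add: subst2_add)
qed

context
  fixes A B :: "'a fps"
  assumes A: "fps_nth A 0 = 0" and B: "fps_nth B 0 = 0"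
begin

lemma subst2_monomial:
  assumes "\<And>k l. fps_nth (fps_nth F k) l = (if k = p then if l = q then c else 0 else 0)"
  shows "fps_subst2 \<iota> F A B = fps_const (\<iota> c) * (A ^ p * B ^ q)"
proof (rule fps_ext)
  fix N
  let ?M = "N + p + q"
  have "fps_nth (fps_subst2 \<iota> F A B) N =
        (\<Sum>k\<le>?M. \<Sum>l\<le>?M. \<iota> (fps_nth (fps_nth F k) l) * fps_nth (A ^ k * B ^ l) N)"
    by (rule fps_subst2_nth) (simp_all add: A B)
  also have "\<dots> = (\<Sum>k\<le>?M. if k = p then (\<Sum>l\<le>?M. if l = q then \<iota> c * fps_nth (A ^ p * B ^ q) N else 0) else 0)"
    by (intro sum.cong) (auto simp: assms zero simp del: sum.delta intro!: sum.cong)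
  also have "\<dots> = \<iota> c * fps_nth (A ^ p * B ^ q) N"
    by simp
  finally show "fps_nth (fps_subst2 \<iota> F A B) N = fps_nth (fps_const (\<iota> c) * (A ^ p * B ^ q)) N"
    by simp
qed

lemma subst2_const: "fps_subst2 \<iota> (fps_const (fps_const c)) A B = fps_const (\<iota> c)"
  by (subst subst2_monomial[where p = 0 and q = 0 and c = c]) auto

lemma subst2_X: "fps_subst2 \<iota> fps_X A B = A"
  by (subst subst2_monomial[where p = 1 and q = 0 and c = 1]) (auto simp: one fps_X_def)

lemma subst2_Y: "fps_subst2 \<iota> (fps_const fps_X) A B = B"
  by (subst subst2_monomial[where p = 0 and q = 1 and c = 1]) (auto simp: one fps_X_def)

lemma subst2_mult: "fps_subst2 \<iota> (F * G) A B = fps_subst2 \<iota> F A B * fps_subst2 \<iota> G A B"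
proof (rule fps_ext)
  fix N
  define f where "f i j = \<iota> (fps_nth (fps_nth F i) j)" for i j
  define g where "g i j = \<iota> (fps_nth (fps_nth G i) j)" for i j
  define m where "m k l = fps_nth (A ^ k * B ^ l) N" for k l
  have m0: "m k l = 0" if "N < k + l" for k l
    unfolding m_def by (rule fps_nth_mult_power_eq_0[OF A B that])
  have "fps_nth (fps_subst2 \<iota> F A B * fps_subst2 \<iota> G A B) N =
        (\<Sum>p\<le>N. (\<Sum>i\<le>N. \<Sum>j\<le>N. f i j * fps_nth (A ^ i * B ^ j) p) *
                (\<Sum>i'\<le>N. \<Sum>j'\<le>N. g i' j' * fps_nth (A ^ i' * B ^ j') (N - p)))"
    by (simp add: fps_mult_nth fps_subst2_nth[OF A B, of _ N] f_def g_def atLeast0AtMost)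
  also have "\<dots> = (\<Sum>p\<le>N. \<Sum>i\<le>N. \<Sum>i'\<le>N. \<Sum>j\<le>N. \<Sum>j'\<le>N. f i j * g i' j' *
                  (fps_nth (A ^ i * B ^ j) p * fps_nth (A ^ i' * B ^ j') (N - p)))"
    unfolding sum_product by (intro sum.cong refl) (simp add: mult_ac)
  also have "\<dots> = (\<Sum>i\<le>N. \<Sum>i'\<le>N. \<Sum>j\<le>N. \<Sum>j'\<le>N. \<Sum>p\<le>N. f i j * g i' j' *
                  (fps_nth (A ^ i * B ^ j) p * fps_nth (A ^ i' * B ^ j') (N - p)))"
    by (subst sum.swap, rule sum.cong[OF refl], subst sum.swap, rule sum.cong[OF refl],
        subst sum.swap, rule sum.cong[OF refl], subst sum.swap, rule refl)
  also have "\<dots> = (\<Sum>i\<le>N. \<Sum>i'\<le>N. \<Sum>j\<le>N. \<Sum>j'\<le>N. f i j * g i' j' * m (i + i') (j + j'))"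
  proof (intro sum.cong refl)
    fix i i' j j'
    have "A ^ (i + i') * B ^ (j + j') = (A ^ i * B ^ j) * (A ^ i' * B ^ j')"
      by (simp add: power_add mult_ac)
    thus "(\<Sum>p\<le>N. f i j * g i' j' * (fps_nth (A ^ i * B ^ j) p * fps_nth (A ^ i' * B ^ j') (N - p))) =
          f i j * g i' j' * m (i + i') (j + j')"
      by (simp add: m_def fps_mult_nth sum_distrib_left atLeast0AtMost)
  qed
  also have "\<dots> = (\<Sum>k\<le>N. \<Sum>i\<le>k. \<Sum>j\<le>N. \<Sum>j'\<le>N. f i j * g (k - i) j' * m k (j + j'))"
    by (subst sum_square_reindex) (auto simp: m0 intro!: sum.neutral sum.cong)
  also have "\<dots> = (\<Sum>k\<le>N. \<Sum>i\<le>k. \<Sum>l\<le>N. \<Sum>j\<le>l. f i j * g (k - i) (l - j) * m k l)"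
    by (rule sum.cong[OF refl], rule sum.cong[OF refl], subst sum_square_reindex) (auto simp: m0 intro!: sum.neutral sum.cong)
  also have "\<dots> = (\<Sum>k\<le>N. \<Sum>l\<le>N. (\<Sum>i\<le>k. \<Sum>j\<le>l. f i j * g (k - i) (l - j)) * m k l)"
    by (rule sum.cong[OF refl], subst sum.swap) (simp add: sum_distrib_right)
  also have "\<dots> = fps_nth (fps_subst2 \<iota> (F * G) A B) N"
    by (simp add: fps_subst2_def fps_mult_nth fps_sum_nth sum mult f_def g_def m_def atLeast0AtMost)
  finally show "fps_nth (fps_subst2 \<iota> (F * G) A B) N =
                fps_nth (fps_subst2 \<iota> F A B * fps_subst2 \<iota> G A B) N" ..
qed

text \<open>
  Substitution is the only ring homomorphism with prescribed values on constants, $x$ and $y$: up to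
  multiples of $x^{N+1}$ and $y^{N+1}$, which are mapped to multiples of $t^{N+1}$, a series is a
  polynomial.  All laws on iterated substitutions below are instances.
\<close>

lemma subst2_unique:
  assumes \<phi>_add: "\<And>F G. \<phi> (F + G) = \<phi> F + \<phi> G" and \<phi>_mult: "\<And>F G. \<phi> (F * G) = \<phi> F * \<phi> G"
    and \<phi>_const: "\<And>c. \<phi> (fps_const (fps_const c)) = fps_const (\<iota> c)"
    and \<phi>_X: "\<phi> fps_X = A" and \<phi>_Y: "\<phi> (fps_const fps_X) = B"
  shows "\<phi> F = fps_subst2 \<iota> F A B"
proof (rule fps_ext)
  fix N
  let ?Y = "fps_const fps_X :: complex fps fps"
  have \<phi>_0: "\<phi> 0 = 0" using \<phi>_add[of 0 0] by simp
  have \<phi>_sum: "\<phi> (\<Sum>x\<in>S. g x) = (\<Sum>x\<in>S. \<phi> (g x))" for S :: "nat set" and g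
    by (induction S rule: infinite_finite_induct) (simp_all add: \<phi>_0 \<phi>_add)
  have \<phi>_1: "\<phi> 1 = 1" using \<phi>_const[of 1] by (simp add: one)
  have \<phi>_power: "\<phi> (H ^ k) = \<phi> H ^ k" for H k
    by (induction k) (simp_all add: \<phi>_1 \<phi>_mult)
  define T where "T = (\<Sum>k\<le>N. \<Sum>l\<le>N. fps_const (fps_const (fps_nth (fps_nth F k) l)) * (fps_X ^ k * ?Y ^ l))"
  define F1 where "F1 = fps_shift (Suc N) F"
  define F2 where "F2 = Abs_fps (\<lambda>k. if k \<le> N then fps_shift (Suc N) (fps_nth F k) else 0)"
  have T_nth: "fps_nth (fps_nth T k) l = (if k \<le> N \<and> l \<le> N then fps_nth (fps_nth F k) l else 0)" for k l
  proof -
    have *: "fps_nth (fps_nth (fps_const (fps_const c) * (fps_X ^ k' * ?Y ^ l')) k) l =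
             (if k' = k then if l' = l then c else 0 else 0)" for c k' l'
      by (auto simp: fps_const_power mult.assoc fps_mult_left_const_nth fps_X_power_mult_nth fps_X_power_nth)
    have "fps_nth (fps_nth T k) l =
            (\<Sum>k'\<le>N. if k' = k then (\<Sum>l'\<le>N. if l' = l then fps_nth (fps_nth F k') l' else 0) else 0)"
      unfolding T_def fps_sum_nth * by (intro sum.cong) auto
    thus ?thesis by auto
  qed
  have F_eq: "F = T + F1 * fps_X ^ Suc N + F2 * ?Y ^ Suc N"
  proof (rule fps_ext, rule fps_ext)
    fix k l
    have "fps_nth (fps_nth (F1 * fps_X ^ Suc N) k) l = (if k \<le> N then 0 else fps_nth (fps_nth F k) l)"
      unfolding fps_X_power_mult_right_nth by (auto simp: F1_def)
    moreover have "fps_nth (fps_nth (F2 * ?Y ^ Suc N) k) l =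
                     (if k \<le> N \<and> \<not> l \<le> N then fps_nth (fps_nth F k) l else 0)"
      unfolding fps_const_power fps_mult_right_const_nth fps_X_power_mult_right_nth
      by (auto simp: F2_def)
    ultimately show "fps_nth (fps_nth F k) l =
        fps_nth (fps_nth (T + F1 * fps_X ^ Suc N + F2 * ?Y ^ Suc N) k) l"
      by (auto simp: T_nth)
  qed
  have vanish: "fps_nth (C * D ^ Suc N) N = 0" if "fps_nth D 0 = 0" for C D :: "'a fps"
    using startsby_zero_power_prefix[OF that, of "Suc N"] by (simp add: fps_mult_nth del: power_Suc)
  have "fps_nth (\<phi> F) N = fps_nth (\<phi> T) N"
    by (subst F_eq) (simp only: \<phi>_add \<phi>_mult \<phi>_power \<phi>_X \<phi>_Y fps_add_nth vanish[OF A] vanish[OF B] add_0_right)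
  also have "\<phi> T = (\<Sum>k\<le>N. \<Sum>l\<le>N. fps_const (\<iota> (fps_nth (fps_nth F k) l)) * (A ^ k * B ^ l))"
    by (simp only: T_def \<phi>_sum \<phi>_mult \<phi>_power \<phi>_X \<phi>_Y \<phi>_const)
  also have "fps_nth \<dots> N = fps_nth (fps_subst2 \<iota> F A B) N"
    by (simp add: fps_sum_nth fps_subst2_def)
  finally show "fps_nth (\<phi> F) N = fps_nth (fps_subst2 \<iota> F A B) N" .
qed

lemma subst2_power: "fps_subst2 \<iota> (F ^ k) A B = fps_subst2 \<iota> F A B ^ k"
  using subst2_const[of 1] by (induction k) (simp_all add: subst2_mult one)

end

end

interpretation id_emb: coeff_embedding id
  by standard auto

interpretation const_emb: coeff_embedding fps_const
  by standard auto

text \<open>Both sides are homomorphisms in \<open>F\<close> with the same values on constants, $x$ and $y$.\<close>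

lemma fps_compose_subst2:
  fixes A B C :: "complex fps"
  assumes "fps_nth A 0 = 0" "fps_nth B 0 = 0" "fps_nth C 0 = 0"
  shows "fps_compose (fps_subst2 id F A B) C = fps_subst2 id F (fps_compose A C) (fps_compose B C)"
  using assms
  by (intro id_emb.subst2_unique[where \<phi> = "\<lambda>F. fps_compose (fps_subst2 id F A B) C"])
     (simp_all add: id_emb.subst2_add id_emb.subst2_mult id_emb.subst2_const id_emb.subst2_X
        id_emb.subst2_Y fps_compose_add_distrib fps_compose_mult_distrib)

text \<open>
  Evaluating $F(x^n, x^m(a+y))$ at $(t^N, \sigma(t))$ is evaluating $F$ at $(t^{Nn}, t^{Nm}(a+\sigma(t)))$.
  This is what connects the series of a transform with the series of the original function.
\<close>

lemma fps_subst2_np_subst: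
  assumes N: "N > 0" and n: "n > 0" and m: "m > 0" and \<sigma>: "fps_nth \<sigma> 0 = 0"
  shows "fps_subst2 id (Rep_conv2 (np_subst n m a F)) (fps_X ^ N) \<sigma> =
         fps_subst2 id (Rep_conv2 F) (fps_X ^ (N * n)) (fps_X ^ (N * m) * (fps_const a + \<sigma>))"
proof -
  define A where "A = (fps_X ^ n :: complex fps fps)"
  define B where "B = (fps_X ^ m * fps_const (fps_const a + fps_X) :: complex fps fps)"
  define \<phi> where "\<phi> F = fps_subst2 id (fps_subst2 fps_const F A B) (fps_X ^ N) \<sigma>" for F
  have AB: "fps_nth A 0 = 0" "fps_nth B 0 = 0"
    using n m by (simp_all add: A_def B_def)
  have XN: "fps_nth (fps_X ^ N :: complex fps) 0 = 0"
    using N by simp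
  note s = id_emb.subst2_add id_emb.subst2_mult[OF XN \<sigma>] id_emb.subst2_const[OF XN \<sigma>]
    id_emb.subst2_X[OF XN \<sigma>] id_emb.subst2_Y[OF XN \<sigma>] id_emb.subst2_power[OF XN \<sigma>]
    const_emb.subst2_add const_emb.subst2_mult[OF AB] const_emb.subst2_const[OF AB]
    const_emb.subst2_X[OF AB] const_emb.subst2_Y[OF AB]
  have "\<phi> (Rep_conv2 F) =
        fps_subst2 id (Rep_conv2 F) (fps_X ^ (N * n)) (fps_X ^ (N * m) * (fps_const a + \<sigma>))"
  proof (rule id_emb.subst2_unique)
    show "\<phi> fps_X = fps_X ^ (N * n)"
      unfolding \<phi>_def by (simp only: s) (simp only: A_def s power_mult)
    have "fps_const (fps_const a + fps_X) = fps_const (fps_const a) + (fps_const fps_X :: complex fps fps)"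
      by simp
    thus "\<phi> (fps_const fps_X) = fps_X ^ (N * m) * (fps_const a + \<sigma>)"
      unfolding \<phi>_def by (simp only: s) (simp only: B_def s power_mult id_apply)
    show "\<phi> (fps_const (fps_const c)) = fps_const (id c)" for c
      unfolding \<phi>_def by (simp only: s id_apply)
  qed (use N n m in \<open>auto simp: \<phi>_def s\<close>)
  thus ?thesis
    by (simp only: \<phi>_def A_def B_def np_subst.rep_eq)
qed

section \<open>Weierstrass division\<close>

lemma sum_mixed_powers_le:
  fixes D R :: real
  assumes "0 \<le> R" "R < D"
  shows "(\<Sum>i<k. D ^ i * R ^ (k - i)) \<le> D ^ k * (R / (D - R))"
proof -
  have "(D - R) * (\<Sum>i<k. D ^ i * R ^ (k - i)) = R * ((D - R) * (\<Sum>i<k. R ^ (k - Suc i) * D ^ i))"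
  proof -
    have "R ^ (k - i) = R * R ^ (k - Suc i)" if "i < k" for i
      using that by (simp add: Suc_diff_Suc flip: power_Suc)
    thus ?thesis unfolding sum_distrib_left by (intro sum.cong refl) (simp add: mult_ac)
  qed
  also have "\<dots> = R * (D ^ k - R ^ k)"
    by (simp only: power_diff_sumr2)
  also have "\<dots> \<le> R * D ^ k"
    using assms by (intro mult_left_mono) auto
  finally show ?thesis
    using assms by (simp add: field_simps)
qed

lemma sum_half_radius_le:
  fixes R :: real
  assumes "0 < R"
  shows "(\<Sum>a\<le>l. (2 * R) ^ a * R ^ (l - a)) \<le> 2 * (2 * R) ^ l"
proof -
  have "(\<Sum>a\<le>l. (2 * R) ^ a * R ^ (l - a)) = (\<Sum>a<l. (2 * R) ^ a * R ^ (l - a)) + (2 * R) ^ l"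
    by (simp flip: lessThan_Suc_atMost)
  also have "\<dots> \<le> 2 * (2 * R) ^ l"
    using sum_mixed_powers_le[of R "2 * R" l] assms by (simp add: mult_ac)
  finally show ?thesis .
qed

text \<open>
  By induction on $l$, from $b_0 b'_l = -\sum_{i<l} b'_i b_{l-i}$.  The geometric sum contributes
  $(M/\beta) \cdot R/(D-R)$, where $\beta = |b_0|$, and $D$ is chosen so that this is $1$.
\<close>

lemma fps_inverse_bound:
  fixes b :: "complex fps"
  assumes b: "\<And>l. norm (fps_nth b l) \<le> M * R ^ l" and b0: "fps_nth b 0 \<noteq> 0" and R: "R > 0"
  obtains A D where "D > 0" "\<And>l. norm (fps_nth (inverse b) l) \<le> A * D ^ l"
proof -
  define \<beta> where "\<beta> = norm (fps_nth b 0)"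
  have \<beta>: "\<beta> > 0" using b0 by (simp add: \<beta>_def)
  have M: "M > 0" using order.strict_trans2[OF \<beta>, of M] b[of 0] by (simp add: \<beta>_def)
  define D where "D = R * (1 + M / \<beta>)"
  have D: "R < D" using R M \<beta> by (simp add: D_def)
  have "norm (fps_nth (inverse b) l) \<le> 1 / \<beta> * D ^ l" for l
  proof (induction l rule: less_induct)
    case (less l)
    show ?case
    proof (cases "l = 0")
      case True
      thus ?thesis by (simp add: fps_inverse_nth_0 \<beta>_def norm_inverse inverse_eq_divide norm_divide)
    next
      case False
      have "0 = fps_nth (inverse b * b) l"
        using False b0 by (simp add: inverse_mult_eq_1)
      also have "\<dots> = (\<Sum>i<l. fps_nth (inverse b) i * fps_nth b (l - i)) + fps_nth (inverse b) l * fps_nth b 0"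
        by (simp add: fps_mult_nth atLeast0AtMost flip: lessThan_Suc_atMost)
      finally have "norm (fps_nth (inverse b) l * fps_nth b 0) =
                    norm (\<Sum>i<l. fps_nth (inverse b) i * fps_nth b (l - i))"
        by (metis add.commute eq_neg_iff_add_eq_0 norm_minus_cancel)
      also have "\<dots> \<le> (\<Sum>i<l. M / \<beta> * (D ^ i * R ^ (l - i)))"
      proof (rule sum_norm_le)
        fix i assume "i \<in> {..<l}"
        hence "norm (fps_nth (inverse b) i * fps_nth b (l - i)) \<le> (1 / \<beta> * D ^ i) * (M * R ^ (l - i))"
          unfolding norm_mult using less.IH[of i] D R \<beta> by (intro mult_mono b) auto
        thus "norm (fps_nth (inverse b) i * fps_nth b (l - i)) \<le> M / \<beta> * (D ^ i * R ^ (l - i))"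
          by (simp add: mult_ac)
      qed
      also have "\<dots> \<le> M / \<beta> * (D ^ l * (R / (D - R)))"
        unfolding sum_distrib_left[symmetric]
        using M \<beta> R D by (intro mult_left_mono sum_mixed_powers_le) auto
      also have "\<dots> = D ^ l"
        using R M \<beta> by (simp add: D_def field_simps)
      finally show ?thesis
        using \<beta> by (simp add: norm_mult \<beta>_def field_simps)
    qed
  qed
  thus ?thesis using that[of D "1 / \<beta>"] D R by simp
qed

text \<open>
  Write $P = \sum_k P_k(y) x^k$ with $P_0 = y^\nu b$, $b(0) \neq 0$.  That $F - qP$ has degree below $\nu$ in $y$
  means that $F_k$ and $\sum_{i \le k} q_i P_{k-i}$ agree after deleting the terms below $y^\nu$ and dividing
  by $y^\nu$.  The summand $i = k$ then becomes $q_k b$, so with $b' = 1/b$ the coefficients $q_k$ are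
  determined recursively.
\<close>

context
  fixes b' :: "complex fps" and \<nu> :: nat and P F :: "complex fps fps"
begin

function weierstrass_quotient_nth :: "nat \<Rightarrow> complex fps" where
  "weierstrass_quotient_nth k = b' * (fps_shift \<nu> (fps_nth F k) -
     (\<Sum>i<k. fps_shift \<nu> (weierstrass_quotient_nth i * fps_nth P (k - i))))"
  by auto
termination by (relation "Wellfounded.measure id") auto

end

declare weierstrass_quotient_nth.simps [simp del]

text \<open>
  A majorant $A D^k (2R)^l$ for the coefficients of $q$ is found by induction on $k$.  In $y$ the radius $2R$
  is used instead of $R$, so that a product with a series bounded by $R^l$ costs only the factor $2$ of
  \<open>sum_half_radius_le\<close> and not $l+1$.  Then $|q_{k,l}| \le K \, (R^k + 2A \sum_{i<k} D^i R^{k-i}) \, (2R)^l$, and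
  $D$ and $A$ are chosen so that the two summands contribute at most half of $A D^k$ each.
\<close>

lemma weierstrass_quotient_bound:
  assumes M: "M \<ge> 1" and R: "R \<ge> 1"
    and P: "\<And>k l. norm (fps_nth (fps_nth P k) l) \<le> M * R ^ (k + l)"
    and F: "\<And>k l. norm (fps_nth (fps_nth F k) l) \<le> M * R ^ (k + l)"
    and b': "\<And>l. norm (fps_nth b' l) \<le> M * R ^ l"
  obtains A D where
    "\<And>k l. norm (fps_nth (weierstrass_quotient_nth b' \<nu> P F k) l) \<le> A * D ^ k * (2 * R) ^ l" "D \<ge> 1" "A \<ge> 0"
proof -
  define q where "q = weierstrass_quotient_nth b' \<nu> P F"
  define K where "K = 2 * M\<^sup>2 * (2 * R) ^ \<nu>"
  have K: "K \<ge> 1" unfolding K_def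
    using M R one_le_power[OF M, of 2] one_le_power[of "2 * R" \<nu>] by (intro mult_ge1_I) auto
  define A where "A = 2 * K"
  define D where "D = R * (1 + 4 * K)"
  have D: "R < D" "D \<ge> 1" using K R by (auto simp: D_def intro!: mult_ge1_I)
  have A: "A \<ge> 0" using K by (simp add: A_def)
  have "norm (fps_nth (q k) l) \<le> A * D ^ k * (2 * R) ^ l" for k l
  proof (induction k arbitrary: l rule: less_induct)
    case (less k)
    define u where "u = fps_shift \<nu> (fps_nth F k) - (\<Sum>i<k. fps_shift \<nu> (q i * fps_nth P (k - i)))"
    define E where "E = R ^ k + 2 * A * (\<Sum>i<k. D ^ i * R ^ (k - i))"
    have E: "E \<ge> 0" using A D R by (auto simp: E_def intro!: add_nonneg_nonneg mult_nonneg_nonneg sum_nonneg)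
    have qP: "norm (fps_nth (q i * fps_nth P (k - i)) l) \<le> 2 * A * M * (D ^ i * R ^ (k - i)) * (2 * R) ^ l"
      if i: "i < k" for i l
    proof -
      have "norm (fps_nth (q i * fps_nth P (k - i)) l) \<le>
            (\<Sum>a\<le>l. (A * M * (D ^ i * R ^ (k - i))) * ((2 * R) ^ a * R ^ (l - a)))"
        unfolding fps_mult_nth atLeast0AtMost
      proof (rule sum_norm_le)
        fix a
        have "norm (fps_nth (q i) a * fps_nth (fps_nth P (k - i)) (l - a)) \<le>
              (A * D ^ i * (2 * R) ^ a) * (M * R ^ ((k - i) + (l - a)))"
          unfolding norm_mult using less.IH[OF i, of a] P A D R by (intro mult_mono) auto
        thus "norm (fps_nth (q i) a * fps_nth (fps_nth P (k - i)) (l - a)) \<le>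
              (A * M * (D ^ i * R ^ (k - i))) * ((2 * R) ^ a * R ^ (l - a))"
          by (simp only: power_add mult_ac)
      qed
      also have "\<dots> \<le> (A * M * (D ^ i * R ^ (k - i))) * (2 * (2 * R) ^ l)"
        unfolding sum_distrib_left[symmetric]
        using A M D R by (intro mult_left_mono sum_half_radius_le) auto
      finally show ?thesis by (simp add: mult_ac)
    qed
    have u: "norm (fps_nth u l) \<le> M * (2 * R) ^ \<nu> * E * (2 * R) ^ l" for l
    proof -
      have "norm (fps_nth (fps_nth F k) (l + \<nu>)) \<le> M * R ^ (k + (l + \<nu>))" by (rule F)
      also have "\<dots> \<le> M * R ^ k * (2 * R) ^ (l + \<nu>)"
        using M R by (simp add: power_add[of _ k] power_mono)
      finally have 1: "norm (fps_nth (fps_nth F k) (l + \<nu>)) \<le> M * R ^ k * (2 * R) ^ (l + \<nu>)" .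
      have 2: "norm (\<Sum>i<k. fps_nth (q i * fps_nth P (k - i)) (l + \<nu>)) \<le>
               (\<Sum>i<k. 2 * A * M * (D ^ i * R ^ (k - i)) * (2 * R) ^ (l + \<nu>))"
        by (intro sum_norm_le qP) auto
      have "norm (fps_nth u l) \<le> M * R ^ k * (2 * R) ^ (l + \<nu>) +
              (\<Sum>i<k. 2 * A * M * (D ^ i * R ^ (k - i)) * (2 * R) ^ (l + \<nu>))"
        unfolding u_def fps_sub_nth fps_sum_nth fps_shift_nth
        by (rule order.trans[OF norm_triangle_ineq4 add_mono[OF 1 2]])
      also have "\<dots> = M * (2 * R) ^ \<nu> * E * (2 * R) ^ l"
        by (simp add: E_def power_add sum_distrib_left distrib_left distrib_right mult_ac)
      finally show ?thesis .
    qed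
    have "norm (fps_nth (q k) l) = norm (fps_nth (u * b') l)"
      unfolding q_def by (subst weierstrass_quotient_nth.simps) (simp add: u_def q_def mult.commute)
    also have "\<dots> \<le> (\<Sum>a\<le>l. M * M * (2 * R) ^ \<nu> * E * ((2 * R) ^ a * R ^ (l - a)))"
      unfolding fps_mult_nth atLeast0AtMost
    proof (rule sum_norm_le)
      fix a
      have "norm (fps_nth u a * fps_nth b' (l - a)) \<le>
            (M * (2 * R) ^ \<nu> * E * (2 * R) ^ a) * (M * R ^ (l - a))"
        unfolding norm_mult using u b' M R E by (intro mult_mono) auto
      thus "norm (fps_nth u a * fps_nth b' (l - a)) \<le>
            M * M * (2 * R) ^ \<nu> * E * ((2 * R) ^ a * R ^ (l - a))"
        by (simp only: mult_ac)
    qed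
    also have "\<dots> \<le> M * M * (2 * R) ^ \<nu> * E * (2 * (2 * R) ^ l)"
      unfolding sum_distrib_left[symmetric]
      using M R E by (intro mult_left_mono sum_half_radius_le) auto
    also have "\<dots> = K * E * (2 * R) ^ l"
      by (simp add: K_def power2_eq_square)
    also have "K * E \<le> A * D ^ k"
    proof -
      have "E \<le> D ^ k + 2 * A * (D ^ k * (R / (D - R)))"
        unfolding E_def using A R D by (intro add_mono mult_left_mono sum_mixed_powers_le power_mono) auto
      also have "2 * A * (D ^ k * (R / (D - R))) = D ^ k"
        using K R by (simp add: A_def D_def field_simps)
      finally show ?thesis using K by (simp add: A_def)
    qed
    finally show ?case using R by (simp add: mult_right_mono)
  qed
  thus ?thesis using that[of A D] A D unfolding q_def by blast
qed

text \<open>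
  Formal and convergent division are proved together, since the quotient is the same series; the formal
  version is what the Newton--Puiseux theorem uses.
\<close>

theorem weierstrass_division:
  fixes P F :: "complex fps fps"
  assumes P0: "fps_nth P 0 \<noteq> 0"
  obtains q where
    "\<And>k l. subdegree (fps_nth P 0) \<le> l \<Longrightarrow> fps_nth (fps_nth (F - q * P) k) l = 0"
    "convergent_fps2 P \<Longrightarrow> convergent_fps2 F \<Longrightarrow> convergent_fps2 q"
proof -
  define \<nu> where "\<nu> = subdegree (fps_nth P 0)"
  define b where "b = fps_shift \<nu> (fps_nth P 0)"
  have P0_eq: "fps_nth P 0 = b * fps_X ^ \<nu>"
    unfolding b_def \<nu>_def by (rule subdegree_decompose)
  have b0: "fps_nth b 0 \<noteq> 0" using P0 by (simp add: b_def \<nu>_def)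
  define q where "q = Abs_fps (weierstrass_quotient_nth (inverse b) \<nu> P F)"
  have "fps_shift \<nu> (fps_nth (q * P) k) = fps_shift \<nu> (fps_nth F k)" for k
  proof -
    have "fps_nth (q * P) k = (\<Sum>i<k. fps_nth q i * fps_nth P (k - i)) + fps_nth q k * fps_nth P 0"
      by (simp add: fps_mult_nth atLeast0AtMost flip: lessThan_Suc_atMost)
    hence "fps_shift \<nu> (fps_nth (q * P) k) =
             (\<Sum>i<k. fps_shift \<nu> (fps_nth q i * fps_nth P (k - i))) + fps_shift \<nu> (fps_nth q k * b * fps_X ^ \<nu>)"
      by (simp add: P0_eq fps_shift_add mult.assoc fps_eq_iff fps_sum_nth)
    also have "fps_shift \<nu> (fps_nth q k * b * fps_X ^ \<nu>) = fps_nth q k * b"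
      by (rule fps_shift_times_fps_X_power')
    also have "\<dots> = fps_shift \<nu> (fps_nth F k) - (\<Sum>i<k. fps_shift \<nu> (fps_nth q i * fps_nth P (k - i)))"
      using inverse_mult_eq_1[OF b0]
      by (simp add: q_def weierstrass_quotient_nth.simps[of "inverse b" \<nu> P F k])
    finally show ?thesis by simp
  qed
  hence shift: "fps_nth (fps_nth (q * P) k) (l + \<nu>) = fps_nth (fps_nth F k) (l + \<nu>)" for k l
    by (metis fps_shift_nth)
  show ?thesis
  proof (rule that)
    fix k l assume "subdegree (fps_nth P 0) \<le> l"
    thus "fps_nth (fps_nth (F - q * P) k) l = 0"
      using shift[of k "l - \<nu>"] by (simp add: \<nu>_def)
  next
    assume "convergent_fps2 P" "convergent_fps2 F"
    obtain M1 R1 where 1: "M1 \<ge> 0" "R1 \<ge> 1" "\<And>k l. norm (fps_nth (fps_nth P k) l) \<le> M1 * R1 ^ (k + l)"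
      using convergent_fps2_bound[OF \<open>convergent_fps2 P\<close>] by blast
    obtain M2 R2 where 2: "M2 \<ge> 0" "R2 \<ge> 1" "\<And>k l. norm (fps_nth (fps_nth F k) l) \<le> M2 * R2 ^ (k + l)"
      using convergent_fps2_bound[OF \<open>convergent_fps2 F\<close>] by blast
    have "norm (fps_nth b l) \<le> (M1 * R1 ^ \<nu>) * R1 ^ l" for l
      using 1(3)[of 0 "l + \<nu>"] by (simp add: b_def power_add mult_ac)
    then obtain M3 R3 where 3: "R3 > 0" "\<And>l. norm (fps_nth (inverse b) l) \<le> M3 * R3 ^ l"
      using fps_inverse_bound[OF _ b0, of "M1 * R1 ^ \<nu>" R1] 1(2) by (metis less_le_trans zero_less_one)
    define M where "M = Max {1, M1, M2, M3}"
    define R where "R = Max {1, R1, R2, R3}"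
    have le: "1 \<le> M" "M1 \<le> M" "M2 \<le> M" "M3 \<le> M" "1 \<le> R" "R1 \<le> R" "R2 \<le> R" "R3 \<le> R"
      by (simp_all add: M_def R_def)
    have mono: "M' * R' ^ e \<le> M * R ^ e" if "M' \<le> M" "0 \<le> R'" "R' \<le> R" for M' R' e
      using that le by (intro mult_mono power_mono) auto
    obtain A D where AD: "\<And>k l. norm (fps_nth (weierstrass_quotient_nth (inverse b) \<nu> P F k) l) \<le> A * D ^ k * (2 * R) ^ l"
        "D \<ge> 1" "A \<ge> 0"
    proof (rule weierstrass_quotient_bound[OF le(1,5)])
      show "norm (fps_nth (fps_nth P k) l) \<le> M * R ^ (k + l)" for k l
        using 1 le by (intro order.trans[OF 1(3) mono]) auto
      show "norm (fps_nth (fps_nth F k) l) \<le> M * R ^ (k + l)" for k l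
        using 2 le by (intro order.trans[OF 2(3) mono]) auto
      show "norm (fps_nth (inverse b) l) \<le> M * R ^ l" for l
        using 3 le by (intro order.trans[OF 3(2) mono]) auto
    qed blast
    show "convergent_fps2 q"
    proof (rule convergent_fps2_boundI)
      show "max D (2 * R) > 0" using AD(2) by simp
      fix k l
      have "norm (fps_nth (fps_nth q k) l) \<le> A * D ^ k * (2 * R) ^ l"
        using AD(1) by (simp add: q_def)
      also have "\<dots> \<le> A * max D (2 * R) ^ k * max D (2 * R) ^ l"
        using AD(2,3) le by (intro mult_mono power_mono) auto
      finally show "norm (fps_nth (fps_nth q k) l) \<le> A * max D (2 * R) ^ (k + l)"
        by (simp add: power_add mult_ac)
    qed
  qed
qed

section \<open>The Newton--Puiseux theorem\<close>

text \<open>The coefficient of $z^l$ in $\sum_{k \le \nu} a_k (c+z)^k$, see \<open>taylor_expansion\<close>.\<close>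

definition taylor_coeff :: "nat \<Rightarrow> (nat \<Rightarrow> 'a::comm_ring_1) \<Rightarrow> 'a \<Rightarrow> nat \<Rightarrow> 'a" where
  "taylor_coeff \<nu> a c l = (\<Sum>k\<le>\<nu>. of_nat (k choose l) * a k * c ^ (k - l))"

lemma taylor_expansion:
  "(\<Sum>k\<le>\<nu>. a k * (c + z) ^ k) = (\<Sum>l\<le>\<nu>. taylor_coeff \<nu> a c l * z ^ l)"
proof -
  have "(\<Sum>k\<le>\<nu>. a k * (c + z) ^ k) = (\<Sum>k\<le>\<nu>. \<Sum>l\<le>\<nu>. of_nat (k choose l) * a k * c ^ (k - l) * z ^ l)"
  proof (rule sum.cong[OF refl])
    fix k assume k: "k \<in> {..\<nu>}"
    have "(c + z) ^ k = (\<Sum>l\<le>k. of_nat (k choose l) * z ^ l * c ^ (k - l))"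
      by (subst add.commute) (rule binomial_ring)
    also have "\<dots> = (\<Sum>l\<le>\<nu>. of_nat (k choose l) * z ^ l * c ^ (k - l))"
      using k by (intro sum.mono_neutral_left) (auto simp: not_le binomial_eq_0)
    finally show "a k * (c + z) ^ k = (\<Sum>l\<le>\<nu>. of_nat (k choose l) * a k * c ^ (k - l) * z ^ l)"
      by (simp add: sum_distrib_left mult_ac)
  qed
  also have "\<dots> = (\<Sum>l\<le>\<nu>. taylor_coeff \<nu> a c l * z ^ l)"
    by (subst sum.swap) (simp add: taylor_coeff_def sum_distrib_right)
  finally show ?thesis .
qed

lemma taylor_coeff_top: "taylor_coeff \<nu> a c \<nu> = a \<nu>"
proof -
  have "taylor_coeff \<nu> a c \<nu> = (\<Sum>k\<le>\<nu>. if k = \<nu> then a \<nu> else 0)"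
    unfolding taylor_coeff_def by (intro sum.cong) (auto simp: binomial_eq_0)
  thus ?thesis by simp
qed

lemma taylor_coeff_subtop: "taylor_coeff (Suc \<nu>) a c \<nu> = a \<nu> + of_nat (Suc \<nu>) * a (Suc \<nu>) * c"
proof -
  have "taylor_coeff (Suc \<nu>) a c \<nu> = taylor_coeff \<nu> a c \<nu> + of_nat (Suc \<nu>) * a (Suc \<nu>) * c"
    by (simp add: taylor_coeff_def)
  thus ?thesis by (simp only: taylor_coeff_top)
qed

lemma taylor_coeff_centre_0:
  assumes "l \<le> \<nu>"
  shows "taylor_coeff \<nu> a 0 l = a l"
proof -
  have "taylor_coeff \<nu> a 0 l = (\<Sum>k\<le>\<nu>. if k = l then a l else 0)"
    unfolding taylor_coeff_def
    by (intro sum.cong) (auto simp: power_0_left binomial_eq_0 not_le)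
  thus ?thesis using assms by simp
qed

lemma taylor_coeff_compose:
  fixes a :: "nat \<Rightarrow> 'a::idom fps"
  assumes "fps_nth C 0 = 0"
  shows "fps_compose (taylor_coeff \<nu> a c l) C = taylor_coeff \<nu> (\<lambda>k. fps_compose (a k) C) (fps_compose c C) l"
  using assms
  by (simp add: taylor_coeff_def fps_compose_sum_distrib fps_compose_mult_distrib fps_compose_power
        flip: fps_of_nat)

text \<open>The polynomial $\sum_{l \le \nu} a_l(x) y^l$ as a double series.\<close>

definition y_poly :: "nat \<Rightarrow> (nat \<Rightarrow> complex fps) \<Rightarrow> complex fps fps" where
  "y_poly \<nu> a = Abs_fps (\<lambda>k. Abs_fps (\<lambda>l. if l \<le> \<nu> then fps_nth (a l) k else 0))"

lemma subst2_y_poly: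
  assumes A: "fps_nth A 0 = 0" and B: "fps_nth B 0 = 0"
  shows "fps_subst2 id (y_poly \<nu> a) A B = (\<Sum>l\<le>\<nu>. fps_compose (a l) A * B ^ l)"
proof -
  define emb where "emb u = Abs_fps (\<lambda>k. fps_const (fps_nth u k))" for u :: "complex fps"
  have emb: "fps_subst2 id (emb u) A B = fps_compose u A" for u
  proof (rule fps_ext)
    fix N
    have "(\<Sum>l\<le>N. fps_nth (fps_const x) l * fps_nth (A ^ k * B ^ l) N) = x * fps_nth (A ^ k) N" for x k
      by (subst sum.mono_neutral_right[of _ "{0}"]) auto
    thus "fps_nth (fps_subst2 id (emb u) A B) N = fps_nth (fps_compose u A) N"
      by (simp add: fps_subst2_def emb_def fps_compose_nth atLeast0AtMost)
  qed
  have "y_poly \<nu> a = (\<Sum>l\<le>\<nu>. emb (a l) * fps_const fps_X ^ l)"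
  proof (rule fps_ext, rule fps_ext)
    fix k j
    have "fps_nth (fps_nth (\<Sum>l\<le>\<nu>. emb (a l) * fps_const fps_X ^ l) k) j =
          (\<Sum>l\<le>\<nu>. if l = j then fps_nth (a j) k else 0)"
      by (simp only: fps_sum_nth fps_const_power fps_mult_right_const_nth, intro sum.cong)
         (auto simp: emb_def fps_X_power_nth)
    thus "fps_nth (fps_nth (y_poly \<nu> a) k) j =
          fps_nth (fps_nth (\<Sum>l\<le>\<nu>. emb (a l) * fps_const fps_X ^ l) k) j"
      by (simp add: y_poly_def)
  qed
  thus ?thesis
    by (simp only: id_emb.subst2_sum id_emb.subst2_mult[OF A B] id_emb.subst2_power[OF A B]
          id_emb.subst2_Y[OF A B] emb)
qed

lemma fps_nth_compose_X_power:
  assumes "n > 0"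
  shows "fps_nth (fps_compose u (fps_X ^ n)) k = (if n dvd k then fps_nth u (k div n) else 0 :: 'a::comm_ring_1)"
proof -
  have "fps_nth (fps_compose u (fps_X ^ n)) k = (\<Sum>i=0..k. if k = n * i then fps_nth u i else 0)"
    unfolding fps_compose_nth by (intro sum.cong) (auto simp: fps_X_power_nth simp flip: power_mult)
  also have "\<dots> = (\<Sum>i=0..k. if n dvd k \<and> i = k div n then fps_nth u i else 0)"
    using assms by (intro sum.cong) auto
  also have "\<dots> = (if n dvd k then fps_nth u (k div n) else 0)"
    by auto
  finally show ?thesis .
qed

text \<open>
  Induction on the order $\nu$ of $g(0,y)$.  Weierstrass division of $y^\nu$ by $g$ makes $g$ a unit times a
  monic polynomial $\sum a_l(x) y^l$ of degree $\nu$ with $a_l(0) = 0$ for $l < \nu$.  Shifting $y$ by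
  $c = -a_{\nu-1}/\nu$ gives coefficients $b_l$ with $b_{\nu-1} = 0$.  If all $b_l$ with $l < \nu$ vanish, $c$ is
  a root.  Otherwise let $m/n$ be the smallest slope $\mathrm{ord}(b_l)/(\nu-l)$ and put $x = t^n$,
  $y = c + t^m z$.  After division by $t^{m\nu}$ the polynomial becomes $\sum B_l(t) z^l$, whose value at $t = 0$
  is monic of degree $\nu$, has no term of degree $\nu-1$ and is not $z^\nu$; so it is not a $\nu$-th power
  of a linear factor, and each of its roots $\alpha$ has multiplicity below $\nu$.  The induction hypothesis
  applies to the series obtained by shifting $z$ by $\alpha$.
\<close>

theorem newton_puiseux:
  fixes g :: "complex fps fps"
  assumes "fps_nth g 0 \<noteq> 0" "fps_nth (fps_nth g 0) 0 = 0"
  shows "\<exists>n \<sigma>. n > 0 \<and> fps_nth \<sigma> 0 = 0 \<and> fps_subst2 id g (fps_X ^ n) \<sigma> = 0"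
  using assms
proof (induction "subdegree (fps_nth g 0)" arbitrary: g rule: less_induct)
  case (less g)
  define \<nu> where "\<nu> = subdegree (fps_nth g 0)"
  have \<nu>: "\<nu> > 0"
    using less.prems by (auto simp: \<nu>_def subdegree_eq_0_iff intro!: Nat.gr0I)
  obtain q where q: "\<And>k l. \<nu> \<le> l \<Longrightarrow> fps_nth (fps_nth (fps_const (fps_X ^ \<nu>) - q * g) k) l = 0"
    using weierstrass_division[OF less.prems(1), where F = "fps_const (fps_X ^ \<nu>)"]
    unfolding \<nu>_def by metis
  have qg_0: "fps_nth (fps_nth (q * g) 0) l = (if l = \<nu> then 1 else 0)" if "l \<le> \<nu>" for l
  proof (cases "l = \<nu>")
    case True
    thus ?thesis using q[of \<nu> 0] by simp
  next
    case False
    hence "fps_nth (fps_nth g 0) (l - i) = 0" for i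
      using that by (intro nth_less_subdegree_zero) (auto simp: \<nu>_def)
    thus ?thesis using False by (simp add: fps_mult_nth)
  qed
  have q00: "fps_nth (fps_nth q 0) 0 \<noteq> 0"
  proof
    assume 0: "fps_nth (fps_nth q 0) 0 = 0"
    have "fps_nth (fps_nth q 0) i * fps_nth (fps_nth g 0) (\<nu> - i) = 0" for i
    proof (cases "i = 0")
      case False
      hence "fps_nth (fps_nth g 0) (\<nu> - i) = 0"
        using \<nu> by (intro nth_less_subdegree_zero) (simp flip: \<nu>_def)
      thus ?thesis by simp
    qed (simp add: 0)
    hence "(\<Sum>i=0..\<nu>. fps_nth (fps_nth q 0) i * fps_nth (fps_nth g 0) (\<nu> - i)) = 0"
      by (simp only: sum.neutral_const)
    thus False using qg_0[of \<nu>] by (simp add: fps_mult_nth)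
  qed
  define a where "a l = Abs_fps (\<lambda>k. fps_nth (fps_nth (q * g) k) l)" for l
  have qg: "q * g = y_poly \<nu> a"
  proof (rule fps_ext, rule fps_ext)
    fix k l
    show "fps_nth (fps_nth (q * g) k) l = fps_nth (fps_nth (y_poly \<nu> a) k) l"
      using q[of l k] by (cases "l \<le> \<nu>"; cases "k = 0") (auto simp: y_poly_def a_def fps_X_power_nth)
  qed
  have a_top: "a \<nu> = 1"
  proof (rule fps_ext)
    show "fps_nth (a \<nu>) k = fps_nth 1 k" for k
      using q[of \<nu> k] by (cases "k = 0") (auto simp: a_def)
  qed
  have a_low: "fps_nth (a l) 0 = 0" if "l < \<nu>" for l
    using qg_0[of l] that by (simp add: a_def)
  \<comment> \<open>The cofactor \<open>q\<close> is a unit, so a root of the polynomial is a root of \<open>g\<close>.\<close>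
  have rootI: "fps_subst2 id g (fps_X ^ n) \<sigma> = 0"
    if "n > 0" "fps_nth \<sigma> 0 = 0" "(\<Sum>l\<le>\<nu>. fps_compose (a l) (fps_X ^ n) * \<sigma> ^ l) = 0" for n \<sigma>
  proof -
    have "fps_subst2 id (q * g) (fps_X ^ n) \<sigma> = 0"
      unfolding qg using that by (simp add: subst2_y_poly)
    hence "fps_subst2 id q (fps_X ^ n) \<sigma> * fps_subst2 id g (fps_X ^ n) \<sigma> = 0"
      using that by (simp add: id_emb.subst2_mult)
    moreover have "fps_nth (fps_subst2 id q (fps_X ^ n) \<sigma>) 0 \<noteq> 0"
      using q00 by (simp add: fps_subst2_def)
    ultimately show ?thesis by auto
  qed
  obtain \<mu> where \<mu>: "\<nu> = Suc \<mu>" using \<nu> by (cases \<nu>) auto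
  define c where "c = - (fps_const (1 / of_nat \<nu>) * a \<mu>)"
  have c0: "fps_nth c 0 = 0" using a_low[of \<mu>] \<mu> by (simp add: c_def)
  define b where "b = taylor_coeff \<nu> a c"
  have b_top: "b \<nu> = 1" by (simp add: b_def taylor_coeff_top a_top)
  have b_subtop: "b \<mu> = 0"
  proof -
    have "of_nat (Suc \<mu>) * fps_const (1 / of_nat (Suc \<mu>)) = (1 :: complex fps)"
      by (simp del: of_nat_Suc flip: fps_of_nat)
    thus ?thesis
      using a_top unfolding b_def \<mu> taylor_coeff_subtop c_def by (simp del: of_nat_Suc flip: mult.assoc)
  qed
  have b_low: "fps_nth (b l) 0 = 0" if "l < \<nu>" for l
  proof -
    have "fps_nth (of_nat (k choose l) * a k * c ^ (k - l)) 0 = 0" if k: "k \<le> \<nu>" for k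
    proof (cases "k = \<nu>")
      case True
      thus ?thesis using \<open>l < \<nu>\<close> c0 by simp
    next
      case False
      thus ?thesis using k a_low[of k] by simp
    qed
    thus ?thesis unfolding b_def taylor_coeff_def fps_sum_nth by (intro sum.neutral) blast
  qed
  have b_root: "(\<Sum>l\<le>\<nu>. fps_compose (a l) (fps_X ^ n) * (fps_compose c (fps_X ^ n) + z) ^ l) =
                (\<Sum>l\<le>\<nu>. fps_compose (b l) (fps_X ^ n) * z ^ l)" if "n > 0" for n z
    unfolding b_def using that by (simp add: taylor_expansion taylor_coeff_compose)
  show ?case
  proof (cases "\<forall>l<\<nu>. b l = 0")
    case True
    hence "(\<Sum>l\<le>\<nu>. fps_compose (b l) (fps_X ^ 1) * 0 ^ l) = 0"
      using \<nu> by (intro sum.neutral) (auto simp: power_0_left)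
    hence "fps_subst2 id g (fps_X ^ 1) c = 0"
      using b_root[of 1 0] c0 by (intro rootI) auto
    thus ?thesis using c0 by (intro exI[of _ 1] exI[of _ c]) auto
  next
    case False
    \<comment> \<open>The minimal slope, attained at \<open>s\<close>, is \<open>m / n\<close>, in general not in lowest terms.\<close>
    define L where "L = {l. l < \<nu> \<and> b l \<noteq> 0}"
    define slope where "slope l = of_nat (subdegree (b l)) / (of_nat (\<nu> - l) :: rat)" for l
    define s where "s = arg_min_on slope L"
    have L: "finite L" "L \<noteq> {}" using False by (auto simp: L_def)
    have "s \<in> L" using arg_min_if_finite(1)[OF L] by (simp add: s_def)
    hence s: "s < \<nu>" "b s \<noteq> 0" by (auto simp: L_def)
    define m where "m = subdegree (b s)"
    define n where "n = \<nu> - s"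
    have n: "n > 0" using s by (simp add: n_def)
    have m: "m > 0" using s b_low[of s] by (auto simp: m_def subdegree_eq_0_iff intro!: Nat.gr0I)
    have slope_le: "m * (\<nu> - l) \<le> n * subdegree (b l)" if "l < \<nu>" "b l \<noteq> 0" for l
    proof -
      have "slope s \<le> slope l"
        unfolding s_def using that by (intro arg_min_least[OF L]) (auto simp: L_def)
      hence "of_nat (m * (\<nu> - l)) \<le> (of_nat (n * subdegree (b l)) :: rat)"
        using that n by (simp add: slope_def m_def n_def field_simps)
      thus ?thesis by (simp only: of_nat_le_iff)
    qed
    define B where "B l = fps_shift (m * (\<nu> - l)) (fps_compose (b l) (fps_X ^ n))" for l
    have B: "fps_compose (b l) (fps_X ^ n) = B l * fps_X ^ (m * (\<nu> - l))" if "l \<le> \<nu>" for l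
    proof (rule fps_ext)
      fix k
      have "fps_nth (fps_compose (b l) (fps_X ^ n)) k = 0" if k: "k < m * (\<nu> - l)"
      proof (cases "b l = 0")
        case False
        have "l < \<nu>" using k by (cases "l < \<nu>") auto
        hence "k < n * subdegree (b l)" using slope_le[OF _ False] k by fastforce
        hence "k div n < subdegree (b l)" using n by (simp add: div_less_iff_less_mult mult.commute)
        hence "fps_nth (b l) (k div n) = 0" by (rule nth_less_subdegree_zero)
        thus ?thesis by (simp add: fps_nth_compose_X_power[OF n])
      qed simp
      thus "fps_nth (fps_compose (b l) (fps_X ^ n)) k = fps_nth (B l * fps_X ^ (m * (\<nu> - l))) k"
        by (auto simp: B_def fps_X_power_mult_right_nth)
    qed
    define \<beta> where "\<beta> l = fps_nth (B l) 0" for l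
    have \<beta>_top: "\<beta> \<nu> = 1" by (simp add: \<beta>_def B_def b_top)
    have \<beta>_subtop: "\<beta> \<mu> = 0" by (simp add: \<beta>_def B_def b_subtop)
    have \<beta>_s: "\<beta> s \<noteq> 0"
      using n s by (simp add: \<beta>_def B_def fps_nth_compose_X_power m_def flip: n_def)
    obtain \<alpha> where \<alpha>: "(\<Sum>l\<le>\<nu>. \<beta> l * \<alpha> ^ l) = 0"
    proof -
      define r where "r = Poly (map \<beta> [0..<Suc \<nu>])"
      have r: "coeff r l = (if l \<le> \<nu> then \<beta> l else 0)" for l
        by (simp add: r_def nth_default_def nth_append)
      have "degree r = \<nu>"
        by (intro antisym degree_le le_degree) (auto simp: r \<beta>_top)
      hence "\<not> constant (poly r)" using \<nu> by (simp add: constant_degree)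
      then obtain z where "poly r z = 0" using fundamental_theorem_of_algebra by blast
      thus ?thesis using that[of z] by (simp add: poly_altdef \<open>degree r = \<nu>\<close> r)
    qed
    define D where "D = taylor_coeff \<nu> B (fps_const \<alpha>)"
    define e where "e = taylor_coeff \<nu> \<beta> \<alpha>"
    have D_e: "fps_nth (D l) 0 = e l" for l
      by (simp add: D_def e_def taylor_coeff_def fps_sum_nth \<beta>_def)
    define g' where "g' = y_poly \<nu> D"
    have g'_0: "fps_nth (fps_nth g' 0) l = (if l \<le> \<nu> then e l else 0)" for l
      by (simp add: g'_def y_poly_def D_e)
    \<comment> \<open>For \<open>\<alpha> \<noteq> 0\<close> the shift creates a term of degree \<open>\<nu> - 1\<close>; for \<open>\<alpha> = 0\<close> the term at \<open>s\<close> is still there.\<close>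
    obtain l where l: "l < \<nu>" "e l \<noteq> 0"
    proof (cases "\<alpha> = 0")
      case True
      hence "e s = \<beta> s" using s by (simp add: e_def taylor_coeff_centre_0)
      thus ?thesis using that[of s] s \<beta>_s by simp
    next
      case False
      have "e \<mu> = of_nat \<nu> * \<alpha>"
        unfolding e_def \<mu> taylor_coeff_subtop using \<beta>_top \<beta>_subtop \<mu> by simp
      hence "e \<mu> \<noteq> 0" using False \<nu> by simp
      thus ?thesis using that[of \<mu>] \<mu> by simp
    qed
    have "fps_nth g' 0 \<noteq> 0" using g'_0[of l] l by auto
    moreover have "fps_nth (fps_nth g' 0) 0 = 0"
      using \<alpha> by (simp add: g'_0 e_def taylor_coeff_def)
    moreover have "subdegree (fps_nth g' 0) < subdegree (fps_nth g 0)"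
      using l subdegree_leI[of "fps_nth g' 0" l] by (simp add: g'_0 \<nu>_def)
    ultimately obtain n' \<sigma>' where n': "n' > 0" and \<sigma>': "fps_nth \<sigma>' 0 = 0"
        "fps_subst2 id g' (fps_X ^ n') \<sigma>' = 0"
      using less.hyps[of g'] by blast
    define w where "w = fps_const \<alpha> + \<sigma>'"
    have w: "(\<Sum>l\<le>\<nu>. fps_compose (B l) (fps_X ^ n') * w ^ l) = 0"
      using \<sigma>' n' by (simp add: g'_def subst2_y_poly D_def w_def taylor_expansion taylor_coeff_compose)
    define N where "N = n * n'"
    define z where "z = fps_X ^ (m * n') * w"
    have N: "N > 0" using n n' by (simp add: N_def)
    have "(\<Sum>l\<le>\<nu>. fps_compose (b l) (fps_X ^ N) * z ^ l) =
          (\<Sum>l\<le>\<nu>. fps_X ^ (m * n' * \<nu>) * (fps_compose (B l) (fps_X ^ n') * w ^ l))"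
    proof (rule sum.cong[OF refl])
      fix l assume l: "l \<in> {..\<nu>}"
      have "fps_X ^ N = fps_compose (fps_X ^ n) (fps_X ^ n' :: complex fps)"
        using n' by (simp add: N_def fps_X_power_compose mult.commute flip: power_mult)
      hence "fps_compose (b l) (fps_X ^ N) = fps_compose (fps_compose (b l) (fps_X ^ n)) (fps_X ^ n')"
        using n n' by (simp add: fps_compose_assoc)
      also have "\<dots> = fps_compose (B l) (fps_X ^ n') * fps_X ^ (m * n' * (\<nu> - l))"
        using l n' by (simp add: B fps_compose_mult_distrib fps_X_power_compose mult_ac flip: power_mult)
      finally have "fps_compose (b l) (fps_X ^ N) * z ^ l =
          fps_X ^ (m * n' * (\<nu> - l) + m * n' * l) * (fps_compose (B l) (fps_X ^ n') * w ^ l)"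
        by (simp add: z_def power_mult_distrib power_add mult_ac flip: power_mult)
      also have "m * n' * (\<nu> - l) + m * n' * l = m * n' * \<nu>"
        using l by (simp flip: distrib_left)
      finally show "fps_compose (b l) (fps_X ^ N) * z ^ l =
          fps_X ^ (m * n' * \<nu>) * (fps_compose (B l) (fps_X ^ n') * w ^ l)" .
    qed
    also have "\<dots> = 0" by (simp only: w mult_zero_right flip: sum_distrib_left)
    finally have "fps_subst2 id g (fps_X ^ N) (fps_compose c (fps_X ^ N) + z) = 0"
      using N m n' c0 by (intro rootI) (simp_all add: b_root z_def)
    thus ?thesis
      using N c0 m n' by (intro exI[of _ N] exI[of _ "fps_compose c (fps_X ^ N) + z"]) (simp add: z_def)
  qed
qed

section \<open>Divisibility in the ring of convergent series\<close>

text \<open>The inverse of a series with nonzero constant term is the quotient of $1$ by it; the remainder is $0$.\<close>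

lemma is_unit_conv2_iff: "is_unit g \<longleftrightarrow> fps_nth (fps_nth (Rep_conv2 g) 0) 0 \<noteq> 0"
proof
  assume "is_unit g"
  then obtain h where "1 = g * h" by (rule dvdE)
  hence "Rep_conv2 g * Rep_conv2 h = 1" by (metis one_conv2.rep_eq times_conv2.rep_eq)
  hence "fps_nth (fps_nth (Rep_conv2 g * Rep_conv2 h) 0) 0 = 1" by simp
  thus "fps_nth (fps_nth (Rep_conv2 g) 0) 0 \<noteq> 0" by auto
next
  assume unit: "fps_nth (fps_nth (Rep_conv2 g) 0) 0 \<noteq> 0"
  hence sd: "subdegree (fps_nth (Rep_conv2 g) 0) = 0" and nz: "fps_nth (Rep_conv2 g) 0 \<noteq> 0"
    by auto
  obtain q where q: "\<And>k l. 0 \<le> l \<Longrightarrow> fps_nth (fps_nth (1 - q * Rep_conv2 g) k) l = 0"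
      "convergent_fps2 q"
    using weierstrass_division[OF nz, of 1] Rep_conv2[of g] convergent_fps2_const[of 1]
    unfolding sd by (metis fps_const_1_eq_1 mem_Collect_eq)
  have "1 - q * Rep_conv2 g = 0" using q(1) by (intro fps_ext) simp
  hence "1 = g * Abs_conv2 q"
    using q(2) by (simp add: Rep_conv2_inject[symmetric] times_conv2.rep_eq one_conv2.rep_eq
                             Abs_conv2_inverse mult.commute)
  thus "is_unit g" by (rule dvdI)
qed

lemma Rep_conv2_var_x_power: "Rep_conv2 (var_x ^ e) = fps_X ^ e"
  by (induction e) (simp_all add: one_conv2.rep_eq times_conv2.rep_eq var_x.rep_eq)

lemma convergent_fps2_shift:
  assumes "convergent_fps2 F"
  shows "convergent_fps2 (fps_shift e F)"
proof -
  obtain M R where 1: "M \<ge> 0" "R \<ge> 1" "\<And>k l. norm (fps_nth (fps_nth F k) l) \<le> M * R ^ (k + l)"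
    using convergent_fps2_bound[OF assms] by blast
  show ?thesis
  proof (rule convergent_fps2_boundI[of R _ "M * R ^ e"])
    fix k l
    show "norm (fps_nth (fps_nth (fps_shift e F) k) l) \<le> M * R ^ e * R ^ (k + l)"
      using 1(3)[of "k + e" l] by (simp add: power_add mult_ac)
  qed (use 1 in auto)
qed

lemma var_x_power_dvd_iff: "var_x ^ e dvd g \<longleftrightarrow> (\<forall>k<e. fps_nth (Rep_conv2 g) k = 0)"
proof
  assume "var_x ^ e dvd g"
  thus "\<forall>k<e. fps_nth (Rep_conv2 g) k = 0"
    by (auto elim!: dvdE simp: times_conv2.rep_eq Rep_conv2_var_x_power fps_X_power_mult_nth)
next
  assume *: "\<forall>k<e. fps_nth (Rep_conv2 g) k = 0"
  have "Rep_conv2 g = fps_X ^ e * fps_shift e (Rep_conv2 g)"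
    using * by (auto simp: fps_eq_iff fps_X_power_mult_nth)
  hence "g = var_x ^ e * Abs_conv2 (fps_shift e (Rep_conv2 g))"
    using convergent_fps2_shift Rep_conv2[of g]
    by (simp add: Rep_conv2_inject[symmetric] times_conv2.rep_eq Rep_conv2_var_x_power Abs_conv2_inverse)
  thus "var_x ^ e dvd g" by (rule dvdI)
qed

lemma var_x_dvd_iff: "var_x dvd g \<longleftrightarrow> fps_nth (Rep_conv2 g) 0 = 0"
  using var_x_power_dvd_iff[of 1 g] by simp

lemma var_x_nonzero: "var_x \<noteq> 0"
  by (simp add: Rep_conv2_inject[symmetric] var_x.rep_eq zero_conv2.rep_eq)

lemma prime_elem_var_x: "prime_elem var_x"
proof (rule prime_elemI)
  show "\<not> is_unit var_x" by (simp add: is_unit_conv2_iff var_x.rep_eq)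
  fix a b assume "var_x dvd a * b"
  thus "var_x dvd a \<or> var_x dvd b" by (simp add: var_x_dvd_iff times_conv2.rep_eq)
qed (rule var_x_nonzero)

lemma var_x_power_decompose:
  assumes "g \<noteq> 0"
  obtains e g' where "g = var_x ^ e * g'" "\<not> var_x dvd g'"
proof -
  have nz: "Rep_conv2 g \<noteq> 0"
    using assms by (simp add: Rep_conv2_inject[symmetric] zero_conv2.rep_eq)
  define e where "e = subdegree (Rep_conv2 g)"
  have "var_x ^ e dvd g"
    by (auto simp: var_x_power_dvd_iff e_def)
  then obtain g' where g': "g = var_x ^ e * g'" by (rule dvdE)
  have "\<not> var_x dvd g'"
  proof
    assume "var_x dvd g'"
    hence "var_x ^ Suc e dvd g" unfolding g' power_Suc2 by (rule mult_dvd_mono[OF dvd_refl])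
    hence "fps_nth (Rep_conv2 g) e = 0" unfolding var_x_power_dvd_iff by blast
    thus False using nz by (simp add: e_def)
  qed
  thus ?thesis using that g' by blast
qed

text \<open>The order of $g(0,y)$; it is used only for $g$ that are not divisible by $x$.\<close>

definition y_order :: "conv2 \<Rightarrow> nat" where
  "y_order g = subdegree (fps_nth (Rep_conv2 g) 0)"

lemma y_order_mult:
  assumes "\<not> var_x dvd g" "\<not> var_x dvd h"
  shows "y_order (g * h) = y_order g + y_order h"
  using assms by (simp add: y_order_def times_conv2.rep_eq var_x_dvd_iff subdegree_mult)

lemma y_order_eq_0_iff:
  assumes "\<not> var_x dvd g"
  shows "y_order g = 0 \<longleftrightarrow> is_unit g"
  using assms by (simp add: y_order_def is_unit_conv2_iff var_x_dvd_iff subdegree_eq_0_iff)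

lemma weierstrass_division_conv2:
  assumes "\<not> var_x dvd P"
  obtains q r where "F = q * P + r"
    "\<And>k l. y_order P \<le> l \<Longrightarrow> fps_nth (fps_nth (Rep_conv2 r) k) l = 0"
proof -
  have P0: "fps_nth (Rep_conv2 P) 0 \<noteq> 0" using assms by (simp add: var_x_dvd_iff)
  obtain q where q: "\<And>k l. y_order P \<le> l \<Longrightarrow> fps_nth (fps_nth (Rep_conv2 F - q * Rep_conv2 P) k) l = 0"
      "convergent_fps2 q"
    using weierstrass_division[OF P0, of "Rep_conv2 F"] Rep_conv2 unfolding y_order_def
    by (metis mem_Collect_eq)
  show ?thesis
  proof (rule that)
    show "F = Abs_conv2 q * P + (F - Abs_conv2 q * P)" by simp
    fix k l assume "y_order P \<le> l"
    thus "fps_nth (fps_nth (Rep_conv2 (F - Abs_conv2 q * P)) k) l = 0"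
      using q by (simp add: minus_conv2.rep_eq times_conv2.rep_eq Abs_conv2_inverse)
  qed
qed

lemma power_dvd_imp_coeff_eq_0:
  assumes G: "\<not> is_unit G" and "G ^ a dvd g" "k + l < a"
  shows "fps_nth (fps_nth (Rep_conv2 g) k) l = 0"
proof -
  have "fps_nth (fps_nth (Rep_conv2 (G ^ a * h)) k) l = 0" if "k + l < a" for h
    using that
  proof (induction a arbitrary: k l h)
    case (Suc a)
    have "fps_nth (fps_nth (Rep_conv2 G) i) j * fps_nth (fps_nth (Rep_conv2 (G ^ a * h)) (k - i)) (l - j) = 0"
      if "i \<le> k" "j \<le> l" for i j
    proof (cases "i = 0 \<and> j = 0")
      case True
      thus ?thesis using G by (simp add: is_unit_conv2_iff)
    next
      case False
      hence "(k - i) + (l - j) < a" using that Suc.prems by auto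
      thus ?thesis using Suc.IH by simp
    qed
    hence "fps_nth (fps_nth (Rep_conv2 G * Rep_conv2 (G ^ a * h)) k) l = 0"
      by (simp add: fps_mult_nth fps_sum_nth del: mult_eq_0_iff)
    thus ?case by (simp add: times_conv2.rep_eq mult.assoc)
  qed simp
  thus ?thesis using assms by (auto elim: dvdE)
qed

text \<open>
  Only finitely many powers of a non-unit divide a nonzero series, because the total order of
  $G^a h$ is at least $a$.
\<close>

lemma power_decompose:
  fixes G g :: conv2
  assumes "\<not> is_unit G" "g \<noteq> 0"
  obtains a g' where "g = G ^ a * g'" "\<not> G dvd g'"
proof -
  obtain k l where kl: "fps_nth (fps_nth (Rep_conv2 g) k) l \<noteq> 0"
    using assms(2) by (auto simp: Rep_conv2_inject[symmetric] zero_conv2.rep_eq fps_eq_iff)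
  have bound: "a \<le> k + l" if "G ^ a dvd g" for a
    using power_dvd_imp_coeff_eq_0[OF assms(1) that, of k l] kl by force
  define a where "a = (GREATEST a. G ^ a dvd g)"
  have "G ^ a dvd g" unfolding a_def
    by (rule GreatestI_nat[where k = 0 and b = "k + l"]) (auto intro: bound)
  then obtain g' where g': "g = G ^ a * g'" by (rule dvdE)
  have "\<not> G dvd g'"
  proof
    assume "G dvd g'"
    hence "G ^ Suc a dvd g" unfolding g' power_Suc2 by (rule mult_dvd_mono[OF dvd_refl])
    hence "Suc a \<le> a" unfolding a_def by (rule Greatest_le_nat[where b = "k + l"]) (rule bound)
    thus False by simp
  qed
  thus ?thesis using that g' by blast
qed

lemma power_decompose_unique:
  fixes G g h :: "'a::idom"
  assumes "G \<noteq> 0" "G ^ a * g = G ^ b * h" "\<not> G dvd g" "\<not> G dvd h"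
  shows "a = b"
proof -
  have le: "b \<le> a" if eq: "G ^ a * g = G ^ b * h" and "\<not> G dvd g" for a b and g h :: 'a
  proof (rule ccontr)
    assume "\<not> b \<le> a"
    hence "G ^ b = G ^ a * (G * G ^ (b - Suc a))"
      by (simp flip: power_Suc power_add)
    hence "g = G * (G ^ (b - Suc a) * h)" using eq assms(1) by (simp add: mult.assoc)
    thus False using that(2) by (metis dvd_triv_left)
  qed
  show ?thesis using le[OF assms(2,3)] le[OF assms(2)[symmetric] assms(4)] by simp
qed

lemma deriv_x_mult: "deriv_x (g * h) = deriv_x g * h + g * deriv_x h"
  by (simp add: Rep_conv2_inject[symmetric] deriv_x.rep_eq times_conv2.rep_eq plus_conv2.rep_eq)

lemma deriv_y_mult: "deriv_y (g * h) = deriv_y g * h + g * deriv_y h"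
proof -
  have "Rep_conv2 (deriv_y (g * h)) = Rep_conv2 (deriv_y g * h + g * deriv_y h)"
  proof (rule fps_ext)
    fix k
    have deriv_sum: "fps_deriv (\<Sum>i\<in>S. u i) = (\<Sum>i\<in>S. fps_deriv (u i))" for S :: "nat set" and u :: "nat \<Rightarrow> complex fps"
      by (induction S rule: infinite_finite_induct) simp_all
    show "fps_nth (Rep_conv2 (deriv_y (g * h))) k = fps_nth (Rep_conv2 (deriv_y g * h + g * deriv_y h)) k"
      by (simp add: deriv_y.rep_eq times_conv2.rep_eq plus_conv2.rep_eq fps_mult_nth deriv_sum sum.distrib add.commute)
  qed
  thus ?thesis by (simp only: Rep_conv2_inject)
qed

lemma y_order_deriv_y:
  assumes "\<not> var_x dvd g" "\<not> is_unit g"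
  shows "\<not> var_x dvd deriv_y g" "y_order (deriv_y g) < y_order g"
proof -
  let ?g = "fps_nth (Rep_conv2 g) 0"
  have pos: "y_order g > 0" using assms y_order_eq_0_iff by blast
  then obtain n where n: "subdegree ?g = Suc n" unfolding y_order_def by (cases "subdegree ?g") auto
  have "fps_nth ?g (Suc n) \<noteq> 0"
    using assms(1) nth_subdegree_nonzero[of ?g] n by (simp add: var_x_dvd_iff)
  hence nz: "fps_nth (fps_deriv ?g) n \<noteq> 0" by (simp del: of_nat_Suc)
  hence "fps_deriv ?g \<noteq> 0" by (metis fps_zero_nth)
  thus "\<not> var_x dvd deriv_y g" by (simp add: var_x_dvd_iff deriv_y.rep_eq)
  show "y_order (deriv_y g) < y_order g"
    using subdegree_leI[OF nz] n by (simp add: y_order_def deriv_y.rep_eq)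
qed

text \<open>
  In characteristic 0 a prime $G$ with $G \nmid D G$ that divides $F$ survives in $F / d$: if $a$ is the
  exponent of $G$ in $d$ and all of $F = d \bar f$ had that exponent, then $G^a$ would divide the
  derivative of $G^a$ times a cofactor prime to $G$.
\<close>

lemma prime_dvd_div_common_divisor:
  fixes D :: "conv2 \<Rightarrow> conv2"
  assumes D: "\<And>g h. D (g * h) = D g * h + g * D h"
    and G: "prime_elem G" "\<not> G dvd D G"
    and F: "d * fbar \<noteq> 0" "G dvd d * fbar" "d dvd D (d * fbar)"
  shows "G dvd fbar"
proof (rule ccontr)
  assume not: "\<not> G dvd fbar"
  have D_power: "D (G ^ Suc a) = of_nat (Suc a) * G ^ a * D G" for a
    by (induction a) (simp_all add: D algebra_simps)
  have unit_of_nat: "is_unit (of_nat (Suc a) :: conv2)" for a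
  proof -
    have "Rep_conv2 (of_nat n) = of_nat n" for n
      by (induction n) (simp_all add: zero_conv2.rep_eq one_conv2.rep_eq plus_conv2.rep_eq)
    thus ?thesis by (simp add: is_unit_conv2_iff del: of_nat_Suc flip: fps_of_nat)
  qed
  have G_nz: "G \<noteq> 0" and G_nu: "\<not> is_unit G" using G(1) by auto
  obtain a d' where d: "d = G ^ a * d'" "\<not> G dvd d'"
    using power_decompose[OF G_nu, of d] F(1) by auto
  have "G dvd d" using F(2) not G(1) by (simp add: prime_elem_dvd_mult_iff)
  then obtain b where a: "a = Suc b" using d by (cases a) auto
  have "G ^ a dvd D d * fbar + d * D fbar"
    using F(3) unfolding D d(1) by (rule dvd_trans[OF dvd_triv_left])
  moreover have "G ^ a dvd d * D fbar" by (simp add: d(1) mult.assoc)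
  ultimately have "G ^ a dvd D d * fbar" by (simp add: dvd_add_left_iff)
  also have "D d * fbar = of_nat (Suc b) * G ^ b * D G * d' * fbar + G ^ a * (D d' * fbar)"
    by (simp only: d(1) a D D_power) (simp only: distrib_right mult.assoc)
  finally have "G ^ a dvd of_nat (Suc b) * G ^ b * D G * d' * fbar" by (simp add: dvd_add_left_iff)
  hence "G ^ b * G dvd G ^ b * (of_nat (Suc b) * D G * d' * fbar)" by (simp add: a mult_ac)
  hence "G dvd of_nat (Suc b) * D G * d' * fbar" using G_nz by simp
  thus False
    using not d(2) G G_nu unit_of_nat[of b] dvd_unit_imp_unit[of G "of_nat (Suc b)"]
    by (auto simp: prime_elem_dvd_mult_iff simp del: of_nat_Suc)
qed

section \<open>Evaluation at a Puiseux series\<close>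

lemma puiseux_pullback_mult:
  assumes "puiseux_denom n s" "k > 0"
  shows "puiseux_pullback (n * k) s = fps_compose (puiseux_pullback n s) (fps_X ^ k)"
proof (rule fps_ext)
  fix j
  show "fps_nth (puiseux_pullback (n * k) s) j = fps_nth (fps_compose (puiseux_pullback n s) (fps_X ^ k)) j"
  proof (cases "k dvd j")
    case True
    then obtain i where "j = k * i" by (rule dvdE)
    thus ?thesis using assms(2) by (simp add: puiseux_pullback_def fps_nth_compose_X_power)
  next
    case False
    have "puiseux_coeff s (of_nat j / of_nat (n * k)) = 0"
    proof (rule ccontr)
      assume "puiseux_coeff s (of_nat j / of_nat (n * k)) \<noteq> 0"
      then obtain i :: nat where "of_nat j / of_nat (n * k) = (of_nat i / of_nat n :: rat)"
        using assms(1) unfolding puiseux_denom_def by blast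
      moreover have "n > 0" using assms(1) by (simp add: puiseux_denom_def)
      ultimately have "(of_nat j :: rat) = of_nat (i * k)"
        using assms(2) by (simp add: field_simps)
      thus False using False by (simp only: of_nat_eq_iff) simp
    qed
    thus ?thesis using False assms(2) by (simp add: puiseux_pullback_def fps_nth_compose_X_power)
  qed
qed

lemma puiseux_pullback_surj:
  assumes "n > 0"
  obtains s where "puiseux_denom n s" "puiseux_pullback n s = \<sigma>"
proof -
  define c where "c q = (if \<exists>k::nat. q = of_nat k / of_nat n
                         then fps_nth \<sigma> (THE k. q = of_nat k / of_nat n) else 0)" for q :: rat
  have c: "c (of_nat k / of_nat n) = fps_nth \<sigma> k" for k
  proof -
    have "(THE k'. (of_nat k / of_nat n :: rat) = of_nat k' / of_nat n) = k"
      using assms by (intro the_equality) auto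
    thus ?thesis by (auto simp: c_def)
  qed
  have denom: "c q \<noteq> 0 \<Longrightarrow> \<exists>k::nat. q = of_nat k / of_nat n" for q
    by (auto simp: c_def split: if_splits)
  hence rep: "puiseux_coeff (Abs_puiseux c) = c"
    using assms by (intro Abs_puiseux_inverse) blast
  show ?thesis
    using that[of "Abs_puiseux c"] assms denom
    by (auto simp: puiseux_denom_def puiseux_pullback_def rep c fps_eq_iff)
qed

lemma puiseux_pullback_nth_0: "fps_nth (puiseux_pullback n s) 0 = puiseux_coeff s 0"
  by (simp add: puiseux_pullback_def)

lemma obtain_puiseux_denom: obtains n where "puiseux_denom n s" "n > 0"
  using puiseux_coeff[of s] unfolding puiseux_denom_def by blast

text \<open>
  Passing from $x^{1/n}$ to $x^{1/(nk)}$ composes the value of $g$ with $t^k$, which is injective; two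
  denominators $n$ and $n'$ are compared through $nn'$.
\<close>

lemma puiseux_root_iff:
  assumes n: "puiseux_denom n s" and s0: "puiseux_coeff s 0 = 0"
  shows "puiseux_root g s \<longleftrightarrow> fps_subst2 id (Rep_conv2 g) (fps_X ^ n) (puiseux_pullback n s) = 0"
proof -
  have indep: "fps_subst2 id (Rep_conv2 g) (fps_X ^ (n * k)) (puiseux_pullback (n * k) s) = 0 \<longleftrightarrow>
               fps_subst2 id (Rep_conv2 g) (fps_X ^ n) (puiseux_pullback n s) = 0"
    if n: "puiseux_denom n s" and k: "k > 0" for n k
  proof -
    have pos: "n > 0" using n by (simp add: puiseux_denom_def)
    have "fps_compose (fps_subst2 id (Rep_conv2 g) (fps_X ^ n) (puiseux_pullback n s)) (fps_X ^ k) =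
          fps_subst2 id (Rep_conv2 g) (fps_X ^ (n * k)) (puiseux_pullback (n * k) s)"
      using k pos s0 n
      unfolding puiseux_pullback_mult[OF n k]
      by (subst fps_compose_subst2)
         (simp_all add: puiseux_pullback_nth_0 fps_X_power_compose mult.commute flip: power_mult)
    moreover have "fps_nth (fps_X ^ k :: complex fps) 0 = 0" using k by simp
    ultimately show ?thesis by (metis fps_compose_eq_0_iff fps_X_neq_zero power_not_zero)
  qed
  show ?thesis
  proof
    assume "puiseux_root g s"
    then obtain n' where n': "puiseux_denom n' s"
        "fps_subst2 id (Rep_conv2 g) (fps_X ^ n') (puiseux_pullback n' s) = 0"
      unfolding puiseux_root_def by blast
    moreover have "n > 0" "n' > 0" using n n' by (simp_all add: puiseux_denom_def)
    ultimately show "fps_subst2 id (Rep_conv2 g) (fps_X ^ n) (puiseux_pullback n s) = 0"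
      using indep[OF n, of n'] indep[OF n'(1), of n] by (simp add: mult.commute)
  qed (use assms in \<open>auto simp: puiseux_root_def\<close>)
qed

lemma puiseux_rootD: "puiseux_root g s \<Longrightarrow> puiseux_coeff s 0 = 0"
  by (simp add: puiseux_root_def)

lemma puiseux_root_mult: "puiseux_root (g * h) s \<longleftrightarrow> puiseux_root g s \<or> puiseux_root h s"
proof (cases "puiseux_coeff s 0 = 0")
  case True
  obtain n where n: "puiseux_denom n s" "n > 0" by (rule obtain_puiseux_denom)
  thus ?thesis
    by (simp add: puiseux_root_iff[OF n(1) True] times_conv2.rep_eq id_emb.subst2_mult
                  puiseux_pullback_nth_0 True)
qed (auto dest: puiseux_rootD)

lemma puiseux_root_dvd: "g dvd h \<Longrightarrow> puiseux_root g s \<Longrightarrow> puiseux_root h s"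
  by (auto elim!: dvdE simp: puiseux_root_mult)

lemma puiseux_root_add: "puiseux_root g s \<Longrightarrow> puiseux_root h s \<Longrightarrow> puiseux_root (g + h) s"
proof -
  assume r: "puiseux_root g s" "puiseux_root h s"
  hence 0: "puiseux_coeff s 0 = 0" by (simp add: puiseux_rootD)
  obtain n where n: "puiseux_denom n s" "n > 0" by (rule obtain_puiseux_denom)
  show ?thesis using r
    by (simp add: puiseux_root_iff[OF n(1) 0] plus_conv2.rep_eq id_emb.subst2_add)
qed

lemma not_puiseux_root_unit:
  assumes "is_unit g"
  shows "\<not> puiseux_root g s"
proof
  assume r: "puiseux_root g s"
  hence 0: "puiseux_coeff s 0 = 0" by (simp add: puiseux_rootD)
  obtain n where n: "puiseux_denom n s" "n > 0" by (rule obtain_puiseux_denom)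
  have "fps_nth (fps_subst2 id (Rep_conv2 g) (fps_X ^ n) (puiseux_pullback n s)) 0 \<noteq> 0"
    using assms by (simp add: fps_subst2_def is_unit_conv2_iff)
  thus False using r by (simp add: puiseux_root_iff[OF n(1) 0])
qed

lemma not_puiseux_root_var_x: "\<not> puiseux_root var_x s"
proof
  assume r: "puiseux_root var_x s"
  hence 0: "puiseux_coeff s 0 = 0" by (simp add: puiseux_rootD)
  obtain n where n: "puiseux_denom n s" "n > 0" by (rule obtain_puiseux_denom)
  show False
    using r n by (simp add: puiseux_root_iff[OF n(1) 0] var_x.rep_eq id_emb.subst2_X puiseux_pullback_nth_0 0)
qed

lemma puiseux_root_power: "puiseux_root (g ^ k) s \<Longrightarrow> puiseux_root g s"
  by (induction k) (auto simp: puiseux_root_mult not_puiseux_root_unit)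

lemma puiseux_root_exists:
  assumes "\<not> var_x dvd g" "\<not> is_unit g"
  obtains s where "puiseux_root g s"
proof -
  obtain n \<sigma> where n: "n > 0" "fps_nth \<sigma> 0 = 0" "fps_subst2 id (Rep_conv2 g) (fps_X ^ n) \<sigma> = 0"
    using newton_puiseux[of "Rep_conv2 g"] assms by (auto simp: var_x_dvd_iff is_unit_conv2_iff)
  obtain s where s: "puiseux_denom n s" "puiseux_pullback n s = \<sigma>"
    using puiseux_pullback_surj[OF n(1)] by blast
  hence "puiseux_coeff s 0 = 0" using n(2) puiseux_pullback_nth_0[of n s] by simp
  thus ?thesis using that[of s] n s by (simp add: puiseux_root_iff)
qed

text \<open>
  Conjugation is the substitution of $\omega t$ for $t$ with an $n$-th root of unity $\omega$, and this leaves
  $x = t^n$ unchanged.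
\<close>

lemma puiseux_root_conj:
  assumes "puiseux_root g s"
  shows "puiseux_root g (puiseux_conj j s)"
proof -
  have s0: "puiseux_coeff s 0 = 0" using assms by (simp add: puiseux_rootD)
  obtain n where n: "puiseux_denom n s" "n > 0" by (rule obtain_puiseux_denom)
  define \<omega> where "\<omega> = cis (2 * pi * real j / real n)"
  have "\<omega> ^ n = cis (2 * pi * real j)"
    using n(2) by (simp add: \<omega>_def DeMoivre)
  hence \<omega>: "\<omega> ^ n = 1" by (simp add: cis_multiple_2pi)
  have n': "puiseux_denom n (puiseux_conj j s)"
    using n by (auto simp: puiseux_denom_def puiseux_conj.rep_eq)
  have "cis (2 * pi * real j * real k / real n) = \<omega> ^ k" for k
    by (simp add: \<omega>_def DeMoivre mult_ac)
  hence pb: "puiseux_pullback n (puiseux_conj j s) = fps_compose (puiseux_pullback n s) (fps_const \<omega> * fps_X)"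
    by (simp add: fps_compose_linear puiseux_pullback_def puiseux_conj.rep_eq of_rat_divide)
  have X: "fps_X ^ n = fps_compose (fps_X ^ n) (fps_const \<omega> * fps_X)"
    by (simp add: fps_X_power_compose power_mult_distrib fps_const_power \<omega>)
  have "fps_subst2 id (Rep_conv2 g) (fps_X ^ n) (puiseux_pullback n (puiseux_conj j s)) =
        fps_compose (fps_subst2 id (Rep_conv2 g) (fps_X ^ n) (puiseux_pullback n s)) (fps_const \<omega> * fps_X)"
    using n s0 by (subst fps_compose_subst2) (simp_all add: puiseux_pullback_nth_0 pb flip: X)
  also have "\<dots> = 0" using assms by (simp add: puiseux_root_iff[OF n(1) s0])
  finally show ?thesis
    using n' s0 by (simp add: puiseux_root_iff puiseux_conj.rep_eq)
qed

lemma puiseux_conj_inverse: "\<exists>i. puiseux_conj i (puiseux_conj j s) = s"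
proof -
  obtain n where n: "puiseux_denom n s" "n > 0" by (rule obtain_puiseux_denom)
  define i where "i = (n - 1) * j"
  have "puiseux_coeff (puiseux_conj i (puiseux_conj j s)) q = puiseux_coeff s q" for q
  proof (cases "puiseux_coeff s q = 0")
    case False
    then obtain k :: nat where q: "q = of_nat k / of_nat n"
      using n(1) unfolding puiseux_denom_def by blast
    have ij: "i + j = n * j" using n(2) by (cases n) (simp_all add: i_def)
    have "cis (2 * pi * of_nat i * of_rat q) * cis (2 * pi * of_nat j * of_rat q) =
          cis (2 * pi * of_nat (i + j) * of_rat q)"
      by (simp add: cis_mult algebra_simps)
    also have "2 * pi * of_nat (i + j) * of_rat q = 2 * pi * real (j * k)"
      unfolding ij using n(2) by (simp add: q of_rat_divide)
    also have "cis (2 * pi * real (j * k)) = 1"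
      by (rule cis_multiple_2pi) simp
    finally show ?thesis by (simp add: puiseux_conj.rep_eq flip: mult.assoc)
  qed (simp add: puiseux_conj.rep_eq)
  thus ?thesis by (auto simp: puiseux_coeff_inject[symmetric])
qed

lemma puiseux_root_conjugate_iff:
  assumes "puiseux_conjugate s t"
  shows "puiseux_root g s \<longleftrightarrow> puiseux_root g t"
proof -
  obtain j where t: "t = puiseux_conj j s" using assms by (auto simp: puiseux_conjugate_def)
  obtain i where "puiseux_conj i t = s" using puiseux_conj_inverse t by blast
  thus ?thesis using puiseux_root_conj t by metis
qed

lemma puiseux_conjugate_refl: "puiseux_conjugate s s"
  unfolding puiseux_conjugate_def
  by (rule exI[of _ 0]) (simp add: puiseux_coeff_inject[symmetric] puiseux_conj.rep_eq)

section \<open>The prime of a Puiseux series\<close>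

text \<open>The ideal of all $g$ with $g(x,s(x)) = 0$ is the principal ideal $(G)$.\<close>

definition puiseux_prime :: "conv2 \<Rightarrow> puiseux \<Rightarrow> bool" where
  "puiseux_prime G s \<longleftrightarrow> prime_elem G \<and> (\<forall>g. puiseux_root g s \<longleftrightarrow> G dvd g)"

text \<open>
  Let $G$ have minimal order $\nu$ in $y$ among the elements of the ideal that are not divisible by $x$.  The
  remainder of a division by $G$ lies in the ideal and has degree below $\nu$ in $y$; were it not $0$, removing
  its power of $x$ (which does not vanish at $s$) would contradict minimality.
\<close>

lemma puiseux_prime_exists:
  assumes "puiseux_root g s" "g \<noteq> 0"
  obtains G where "puiseux_prime G s"
proof -
  have s0: "puiseux_coeff s 0 = 0" using assms by (simp add: puiseux_rootD)
  \<comment> \<open>Dividing a remainder of \<open>y\<close>-degree below \<open>\<nu>\<close> by its power of \<open>x\<close> leaves a series of \<open>y\<close>-order below \<open>\<nu>\<close>.\<close>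
  have x_free: "\<exists>g'. \<not> var_x dvd g' \<and> puiseux_root g' s \<and>
      (\<forall>\<nu>. (\<forall>k. \<forall>l\<ge>\<nu>. fps_nth (fps_nth (Rep_conv2 g) k) l = 0) \<longrightarrow> y_order g' < \<nu>)"
    if root: "puiseux_root g s" and nz: "g \<noteq> 0" for g
  proof -
    obtain e g' where g': "g = var_x ^ e * g'" "\<not> var_x dvd g'"
      using var_x_power_decompose[OF nz] by blast
    have "puiseux_root g' s"
      using root puiseux_root_power not_puiseux_root_var_x by (auto simp: g' puiseux_root_mult)
    moreover have "y_order g' < \<nu>" if "\<forall>k. \<forall>l\<ge>\<nu>. fps_nth (fps_nth (Rep_conv2 g) k) l = 0" for \<nu>
    proof (rule ccontr)
      assume "\<not> y_order g' < \<nu>"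
      hence "fps_nth (fps_nth (Rep_conv2 g) e) (y_order g') = 0" using that by simp
      moreover have "fps_nth (Rep_conv2 g) e = fps_nth (Rep_conv2 g') 0"
        by (simp add: g' times_conv2.rep_eq Rep_conv2_var_x_power fps_X_power_mult_nth)
      ultimately show False using g'(2) by (simp add: y_order_def var_x_dvd_iff)
    qed
    ultimately show ?thesis using g'(2) by blast
  qed
  define \<nu> where "\<nu> = (LEAST \<nu>. \<exists>G. \<not> var_x dvd G \<and> puiseux_root G s \<and> y_order G = \<nu>)"
  have "\<exists>\<nu> G. \<not> var_x dvd G \<and> puiseux_root G s \<and> y_order G = \<nu>"
    using x_free[OF assms] by blast
  hence "\<exists>G. \<not> var_x dvd G \<and> puiseux_root G s \<and> y_order G = \<nu>"
    unfolding \<nu>_def by (rule LeastI_ex)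
  then obtain G where G: "\<not> var_x dvd G" "puiseux_root G s" "y_order G = \<nu>" by blast
  have min: "\<nu> \<le> y_order H" if "\<not> var_x dvd H" "puiseux_root H s" for H
    unfolding \<nu>_def by (rule Least_le) (use that in blast)
  have root_iff: "puiseux_root g s \<longleftrightarrow> G dvd g" for g
  proof
    assume g: "puiseux_root g s"
    obtain q r where qr: "g = q * G + r"
        "\<And>k l. \<nu> \<le> l \<Longrightarrow> fps_nth (fps_nth (Rep_conv2 r) k) l = 0"
      using weierstrass_division_conv2[OF G(1), of g] G(3) by metis
    have "puiseux_root ((- q) * G) s" using G(2) by (simp only: puiseux_root_mult) simp
    hence "puiseux_root ((- q) * G + g) s" using g by (rule puiseux_root_add)
    hence "puiseux_root r s" by (simp add: qr)
    have "r = 0"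
    proof (rule ccontr)
      assume "r \<noteq> 0"
      then obtain r' where "\<not> var_x dvd r'" "puiseux_root r' s" "y_order r' < \<nu>"
        using x_free[OF \<open>puiseux_root r s\<close>] qr(2) by blast
      thus False using min by fastforce
    qed
    thus "G dvd g" by (simp add: qr)
  qed (use G(2) puiseux_root_dvd in blast)
  have "prime_elem G"
  proof (rule prime_elemI)
    show "G \<noteq> 0" using G(1) by auto
    show "\<not> is_unit G" using G(2) not_puiseux_root_unit by blast
  qed (use root_iff puiseux_root_mult in blast)
  thus ?thesis using that[of G] root_iff unfolding puiseux_prime_def by blast
qed

lemma puiseux_primeD:
  assumes "puiseux_prime G s"
  shows "prime_elem G" "puiseux_root g s \<longleftrightarrow> G dvd g" "puiseux_root G s"
    "\<not> var_x dvd G" "\<not> G dvd var_x" "\<not> G dvd deriv_y G" "G \<noteq> 0" "\<not> is_unit G"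
proof -
  show prime: "prime_elem G" and root: "puiseux_root g s \<longleftrightarrow> G dvd g" for g
    using assms by (auto simp: puiseux_prime_def)
  show "puiseux_root G s" by (simp add: root)
  show nx: "\<not> G dvd var_x" using not_puiseux_root_var_x root by blast
  show "G \<noteq> 0" "\<not> is_unit G" using prime by auto
  \<comment> \<open>If \<open>G = x H\<close>, then \<open>G\<close> divides \<open>H\<close>, so that \<open>x\<close> would be a unit.\<close>
  show x: "\<not> var_x dvd G"
  proof
    assume "var_x dvd G"
    then obtain H where H: "G = var_x * H" by (rule dvdE)
    hence "G dvd H" using nx prime by (metis dvd_refl prime_elem_dvd_mult_iff)
    then obtain K where "H = G * K" by (rule dvdE)
    hence "H * (var_x * K) = H * 1" by (simp add: H mult_ac)
    moreover have "H \<noteq> 0" using \<open>G \<noteq> 0\<close> H by auto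
    ultimately have "var_x * K = 1" by (metis mult_left_cancel)
    hence "is_unit var_x" by (metis dvd_triv_left)
    thus False using prime_elem_var_x by simp
  qed
  show "\<not> G dvd deriv_y G"
  proof
    assume "G dvd deriv_y G"
    then obtain K where K: "deriv_y G = G * K" by (rule dvdE)
    note * = y_order_deriv_y[OF x \<open>\<not> is_unit G\<close>]
    have "\<not> var_x dvd K" using *(1) by (auto simp: K)
    thus False using *(2) by (simp add: K y_order_mult x)
  qed
qed

lemma prime_elem_dvd_prod_iff:
  fixes p :: "'a::algebraic_semidom"
  assumes "prime_elem p" "finite A"
  shows "p dvd prod f A \<longleftrightarrow> (\<exists>x\<in>A. p dvd f x)"
  using assms(2,1) by induction (auto simp: prime_elem_dvd_mult_iff)

lemma y_order_power: "\<not> var_x dvd G \<Longrightarrow> y_order (G ^ a) = a * y_order G"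
  using prime_elem_var_x
proof (induction a)
  case 0
  have "\<not> var_x dvd 1" using prime_elem_var_x by simp
  thus ?case by (simp add: y_order_eq_0_iff)
next
  case (Suc a)
  hence "\<not> var_x dvd G ^ a" using prime_elem_dvd_power by blast
  thus ?case using Suc by (simp add: y_order_mult)
qed

text \<open>
  Factorization into primes that have Puiseux series: a non-unit has a series by the Newton--Puiseux
  theorem, the full power of the corresponding prime is split off, and this lowers the order in $y$.
\<close>

lemma puiseux_prime_factorization:
  assumes "\<not> var_x dvd g"
  shows "\<exists>u L G A. is_unit u \<and> g = u * (\<Prod>i=1..L::nat. G i ^ A i) \<and>
           (\<forall>i\<in>{1..L}. A i \<ge> (1::nat) \<and> (\<exists>\<sigma>. puiseux_prime (G i) \<sigma>)) \<and>
           (\<forall>i\<in>{1..L}. \<forall>i'\<in>{1..L}. i \<noteq> i' \<longrightarrow> \<not> G i dvd G i')"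
  using assms
proof (induction "y_order g" arbitrary: g rule: less_induct)
  case (less g)
  show ?case
  proof (cases "is_unit g")
    case True
    thus ?thesis by (intro exI[of _ g] exI[of _ "0::nat"]) auto
  next
    case False
    then obtain s where s: "puiseux_root g s" using puiseux_root_exists less.prems by blast
    have "g \<noteq> 0" using less.prems by auto
    then obtain P where P: "puiseux_prime P s" using puiseux_prime_exists s by blast
    note P_D = puiseux_primeD[OF P]
    obtain a g' where g': "g = P ^ a * g'" "\<not> P dvd g'"
      using power_decompose[OF P_D(8) \<open>g \<noteq> 0\<close>] by blast
    have a: "a \<ge> 1" using s g' P_D(2) by (cases a) auto
    have nx: "\<not> var_x dvd g'" "\<not> var_x dvd P ^ a" using less.prems unfolding g'(1) by auto
    have "y_order P > 0" using y_order_eq_0_iff[OF P_D(4)] P_D(8) by simp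
    hence "y_order g' < y_order g" using nx a P_D(4) by (simp add: g'(1) y_order_mult y_order_power)
    from less.hyps[OF this nx(1)] obtain u L G A where
      u: "is_unit u" and g'_eq: "g' = u * (\<Prod>i=1..L::nat. G i ^ A i)" and
      AG: "\<forall>i\<in>{1..L}. A i \<ge> 1 \<and> (\<exists>\<sigma>. puiseux_prime (G i) \<sigma>)" and
      distinct: "\<forall>i\<in>{1..L}. \<forall>i'\<in>{1..L}. i \<noteq> i' \<longrightarrow> \<not> G i dvd G i'"
      by (elim exE conjE) (rule that)
    have A: "A i \<ge> 1" and G: "\<exists>\<sigma>. puiseux_prime (G i) \<sigma>" if "i \<in> {1..L}" for i
      using AG that by blast+
    have PG: "\<not> P dvd G i" if i: "i \<in> {1..L}" for i
    proof
      assume "P dvd G i"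
      also have "G i dvd G i ^ A i" using A[OF i] by (intro dvd_power) auto
      also have "\<dots> dvd (\<Prod>i=1..L. G i ^ A i)" using i by (intro dvd_prodI) auto
      also have "\<dots> dvd g'" by (simp add: g'_eq)
      finally show False using g'(2) by simp
    qed
    have GP: "\<not> G i dvd P" if i: "i \<in> {1..L}" for i
    proof
      assume "G i dvd P"
      moreover have "\<not> is_unit (G i)" using G[OF i] puiseux_primeD(8) by blast
      ultimately have "P dvd G i"
        using irreducibleD'[OF prime_elem_imp_irreducible[OF P_D(1)]] by blast
      thus False using PG[OF i] by simp
    qed
    define G' where "G' = G(Suc L := P)"
    define A' where "A' = A(Suc L := a)"
    have "(\<Prod>i=1..Suc L. G' i ^ A' i) = (\<Prod>i=1..L. G i ^ A i) * P ^ a"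
      by (simp add: G'_def A'_def)
    hence "g = u * (\<Prod>i=1..Suc L. G' i ^ A' i)" by (simp add: g'(1) g'_eq mult_ac)
    moreover have "\<forall>i\<in>{1..Suc L}. A' i \<ge> 1 \<and> (\<exists>\<sigma>. puiseux_prime (G' i) \<sigma>)"
      using A G a P by (auto simp: A'_def G'_def le_Suc_eq)
    moreover have "\<forall>i\<in>{1..Suc L}. \<forall>i'\<in>{1..Suc L}. i \<noteq> i' \<longrightarrow> \<not> G' i dvd G' i'"
      using distinct PG GP by (auto simp: G'_def le_Suc_eq)
    ultimately show ?thesis using u by blast
  qed
qed

text \<open>
  The factor $G_i$ that has \<open>s\<close> as a series is $P$ up to a unit, and since the factors are pairwise not
  associated, $P$ divides none of the others.
\<close>

lemma algebraic_multiplicity_imp_exact_power: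
  assumes P: "puiseux_prime P s" and mult: "algebraic_multiplicity g s \<alpha>"
  shows "\<alpha> \<ge> 1 \<and> (\<exists>g'. g = P ^ \<alpha> * g' \<and> \<not> P dvd g')"
proof -
  note P_D = puiseux_primeD[OF P]
  from mult obtain u \<alpha>\<^sub>0 L G A \<sigma> i where
    u: "is_unit u" and
    irr: "\<And>i. i \<in> {1..L::nat} \<Longrightarrow> irreducible (G i)" and A: "\<And>i. i \<in> {1..L} \<Longrightarrow> A i \<ge> 1" and
    root: "\<And>i. i \<in> {1..L} \<Longrightarrow> puiseux_root (G i) (\<sigma> i)" and
    distinct: "\<And>i i'. i \<in> {1..L} \<Longrightarrow> i' \<in> {1..L} \<Longrightarrow> i \<noteq> i' \<Longrightarrow> \<not> (G i dvd G i' \<and> G i' dvd G i)" and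
    g: "g = u * var_x ^ \<alpha>\<^sub>0 * (\<Prod>i=1..L. G i ^ A i)" and
    i: "i \<in> {1..L}" "puiseux_conjugate (\<sigma> i) s" "A i = \<alpha>"
    unfolding algebraic_multiplicity_def by blast
  have "P dvd G i"
    using root[OF i(1)] puiseux_root_conjugate_iff[OF i(2)] P_D(2) by blast
  then obtain c where c: "G i = P * c" by (rule dvdE)
  have c_unit: "is_unit c" using irreducibleD[OF irr[OF i(1)] c] P_D(8) by blast
  have other: "\<not> P dvd G i' ^ A i'" if "i' \<in> {1..L} - {i}" for i'
  proof
    assume "P dvd G i' ^ A i'"
    hence "P dvd G i'" by (rule prime_elem_dvd_power[OF P_D(1)])
    have i': "i' \<in> {1..L}" "i' \<noteq> i" using that by auto
    have "G i dvd G i'" using \<open>P dvd G i'\<close> c_unit by (simp add: c mult_unit_dvd_iff)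
    moreover have "G i' dvd P" using irreducibleD'[OF irr[OF i'(1)] \<open>P dvd G i'\<close>] P_D(8) by blast
    hence "G i' dvd G i" by (simp add: c)
    ultimately show False using distinct[OF i(1) i'(1)] i'(2) by blast
  qed
  define g' where "g' = u * var_x ^ \<alpha>\<^sub>0 * c ^ \<alpha> * (\<Prod>i'\<in>{1..L} - {i}. G i' ^ A i')"
  have "g = P ^ \<alpha> * g'"
    unfolding g g'_def using i(1) by (subst prod.remove[of _ i]) (simp_all add: i(3) c power_mult_distrib mult_ac)
  moreover have "\<not> P dvd g'"
    using P_D(1,5,8) other u c_unit dvd_unit_imp_unit[of P u] dvd_unit_imp_unit[of P c]
      prime_elem_dvd_power[OF P_D(1), of var_x \<alpha>\<^sub>0] prime_elem_dvd_power[OF P_D(1), of c \<alpha>]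
    by (auto simp: g'_def prime_elem_dvd_mult_iff prime_elem_dvd_prod_iff simp del: Diff_iff)
  ultimately show ?thesis using A[OF i(1)] i(3) by blast
qed

text \<open>
  For the converse direction the factorization of $g$ into primes is used with \<open>s\<close> itself as the chosen series
  of the factor divisible by $P$; that its exponent is \<open>\<alpha>\<close> then follows from the direction already proved.
\<close>

lemma algebraic_multiplicity_iff_exact_power:
  assumes P: "puiseux_prime P s" and g: "g \<noteq> 0"
  shows "algebraic_multiplicity g s \<alpha> \<longleftrightarrow> \<alpha> \<ge> 1 \<and> (\<exists>g'. g = P ^ \<alpha> * g' \<and> \<not> P dvd g')"
proof
  note P_D = puiseux_primeD[OF P]
  assume *: "\<alpha> \<ge> 1 \<and> (\<exists>g'. g = P ^ \<alpha> * g' \<and> \<not> P dvd g')"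
  then obtain g' where g': "g = P ^ \<alpha> * g'" "\<not> P dvd g'" by blast
  obtain e g1 where g1: "g = var_x ^ e * g1" "\<not> var_x dvd g1" using var_x_power_decompose[OF g] by blast
  obtain u L G A where
      u: "is_unit u" and g1_eq: "g1 = u * (\<Prod>i=1..L::nat. G i ^ A i)" and
      A: "\<And>i. i \<in> {1..L} \<Longrightarrow> A i \<ge> 1" and
      G: "\<And>i. i \<in> {1..L} \<Longrightarrow> \<exists>\<sigma>. puiseux_prime (G i) \<sigma>" and
      distinct: "\<And>i i'. i \<in> {1..L} \<Longrightarrow> i' \<in> {1..L} \<Longrightarrow> i \<noteq> i' \<Longrightarrow> \<not> G i dvd G i'"
    using puiseux_prime_factorization[OF g1(2)] by blast
  obtain \<sigma> where \<sigma>: "\<And>i. i \<in> {1..L} \<Longrightarrow> puiseux_prime (G i) (\<sigma> i)" using G by metis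
  have "P dvd g" using * by (auto simp: g'(1) intro: dvd_mult2)
  hence "\<exists>i\<in>{1..L}. P dvd G i"
    using P_D(1,5,8) u prime_elem_dvd_power[OF P_D(1)] dvd_unit_imp_unit[of P u]
    by (auto simp: g1(1) g1_eq prime_elem_dvd_mult_iff prime_elem_dvd_prod_iff)
  then obtain i where i: "i \<in> {1..L}" "P dvd G i" by blast
  have "algebraic_multiplicity g s (A i)"
    unfolding algebraic_multiplicity_def
  proof (intro exI conjI)
    show "\<forall>i'\<in>{1..L}. irreducible (G i') \<and> A i' \<ge> 1 \<and> puiseux_root (G i') ((\<sigma>(i := s)) i')"
    proof
      fix i' assume i': "i' \<in> {1..L}"
      show "irreducible (G i') \<and> A i' \<ge> 1 \<and> puiseux_root (G i') ((\<sigma>(i := s)) i')"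
        using puiseux_primeD(1,3)[OF \<sigma>[OF i']] A[OF i'] i(2) P_D(2)
        by (simp add: prime_elem_imp_irreducible)
    qed
    show "\<forall>i\<in>{1..L}. \<forall>i'\<in>{1..L}. i \<noteq> i' \<longrightarrow> \<not> (G i dvd G i' \<and> G i' dvd G i)"
      using distinct by blast
    show "g = u * var_x ^ e * (\<Prod>i=1..L. G i ^ A i)" by (simp add: g1(1) g1_eq mult_ac)
    show "\<exists>i'\<in>{1..L}. puiseux_conjugate ((\<sigma>(i := s)) i') s \<and> A i' = A i"
      using i(1) puiseux_conjugate_refl by (intro bexI[of _ i]) auto
  qed (rule u)
  moreover from algebraic_multiplicity_imp_exact_power[OF P this] obtain g'' where
    "g = P ^ A i * g''" "\<not> P dvd g''" by blast
  hence "A i = \<alpha>" using power_decompose_unique[of P "A i" g'' \<alpha> g'] g' P_D(7) by simp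
  ultimately show "algebraic_multiplicity g s \<alpha>" by simp
qed (rule algebraic_multiplicity_imp_exact_power[OF P])

section \<open>Square-free factors and the reduced function\<close>

lemma squarefree_factorizationE:
  assumes "squarefree_factorization g h"
  obtains n where "\<forall>j. j \<notin> {1..n} \<longrightarrow> h j = 1" "n = 0 \<longrightarrow> is_unit g"
    "n \<noteq> 0 \<longrightarrow> g = (\<Prod>j=1..n. h j ^ j)" "\<forall>j\<in>{1..n}. squarefree (h j)"
    "\<forall>j\<in>{1..n}. \<forall>j'\<in>{1..n}. j \<noteq> j' \<longrightarrow> coprime (h j) (h j')"
proof -
  from assms obtain n where n: "\<forall>j. j \<notin> {1..n} \<longrightarrow> h j = 1"
    "if n = 0 then is_unit g else g = (\<Prod>j=1..n. h j ^ j) \<and> \<not> is_unit (h n)"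
    "\<forall>j\<in>{1..n}. squarefree (h j)"
    "\<forall>j\<in>{1..n}. \<forall>j'\<in>{1..n}. j \<noteq> j' \<longrightarrow> coprime (h j) (h j')"
    unfolding squarefree_factorization_def by (elim exE conjE)
  show ?thesis
    by (rule that[OF n(1) _ _ n(3,4)]) (use n(2) in simp_all)
qed

lemma squarefree_factorization_nonzero:
  assumes "squarefree_factorization g h"
  shows "g \<noteq> 0" "h j \<noteq> 0" "h j dvd g"
proof -
  obtain n where n': "\<forall>j. j \<notin> {1..n} \<longrightarrow> h j = 1" "n = 0 \<longrightarrow> is_unit g"
    "n \<noteq> 0 \<longrightarrow> g = (\<Prod>j=1..n. h j ^ j)" "\<forall>j\<in>{1..n}. squarefree (h j)"
    "\<forall>j\<in>{1..n}. \<forall>j'\<in>{1..n}. j \<noteq> j' \<longrightarrow> coprime (h j) (h j')"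
    by (rule squarefree_factorizationE[OF assms])
  note n = n'[rule_format]
  have h: "h j \<noteq> 0" for j
  proof (cases "j \<in> {1..n}")
    case True
    thus ?thesis using n(4)[OF True] by auto
  qed (simp add: n(1))
  thus "h j \<noteq> 0" .
  show "g \<noteq> 0"
  proof (cases "n = 0")
    case False
    thus ?thesis using h by (subst n(3)) (simp_all add: prod_zero_iff)
  qed (use n(2) in auto)
  show "h j dvd g"
  proof (cases "j \<in> {1..n}")
    case True
    have "h j dvd h j ^ j" using True by (intro dvd_power) auto
    also have "\<dots> dvd (\<Prod>j=1..n. h j ^ j)" using True by (intro dvd_prodI) auto
    also have "\<dots> = g" using n(3) True by simp
    finally show ?thesis .
  qed (simp add: n(1))
qed

text \<open>
  If $P$ divides $h_j$, it does so exactly once and divides no other factor, so its exponent in $g$ is $j$.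
  Conversely, if the exponent $j$ is positive, $P$ divides some $h_{j'}$, and then $j' = j$.
\<close>

lemma algebraic_multiplicity_iff_root_squarefree_factor:
  assumes P: "puiseux_prime P s" and sq: "squarefree_factorization g h"
  shows "algebraic_multiplicity g s j \<longleftrightarrow> puiseux_root (h j) s"
proof -
  note P_D = puiseux_primeD[OF P]
  note mult_iff = algebraic_multiplicity_iff_exact_power[OF P squarefree_factorization_nonzero(1)[OF sq]]
  obtain n where n': "\<forall>j. j \<notin> {1..n} \<longrightarrow> h j = 1" "n = 0 \<longrightarrow> is_unit g"
    "n \<noteq> 0 \<longrightarrow> g = (\<Prod>j=1..n. h j ^ j)" "\<forall>j\<in>{1..n}. squarefree (h j)"
    "\<forall>j\<in>{1..n}. \<forall>j'\<in>{1..n}. j \<noteq> j' \<longrightarrow> coprime (h j) (h j')"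
    by (rule squarefree_factorizationE[OF sq])
  note n = n'[rule_format]
  have root_imp: "algebraic_multiplicity g s j" if root: "puiseux_root (h j) s" for j
  proof -
    have j: "j \<in> {1..n}" using root n(1) not_puiseux_root_unit by fastforce
    hence g: "g = (\<Prod>j=1..n. h j ^ j)" using n(3) by simp
    obtain c where c: "h j = P * c" using root P_D(2) by (auto elim: dvdE)
    have Pc: "\<not> P dvd c"
    proof
      assume "P dvd c"
      hence "P\<^sup>2 dvd h j" by (simp add: c power2_eq_square)
      thus False using n(4)[OF j] P_D(8) unfolding squarefree_def by blast
    qed
    have other: "\<not> P dvd h j' ^ j'" if "j' \<in> {1..n} - {j}" for j'
    proof
      assume "P dvd h j' ^ j'"
      hence "P dvd h j'" by (rule prime_elem_dvd_power[OF P_D(1)])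
      moreover have "coprime (h j) (h j')" using n(5)[OF j] that by blast
      ultimately show False using P_D(8) by (auto simp: c coprime_def)
    qed
    define g' where "g' = c ^ j * (\<Prod>j'\<in>{1..n} - {j}. h j' ^ j')"
    have "g = P ^ j * g'"
      unfolding g g'_def using j by (subst prod.remove[of _ j]) (simp_all add: c power_mult_distrib mult_ac)
    moreover have "\<not> P dvd g'"
      using P_D(1) Pc other prime_elem_dvd_power[OF P_D(1), of c j]
      by (auto simp: g'_def prime_elem_dvd_mult_iff prime_elem_dvd_prod_iff simp del: Diff_iff)
    moreover have "j \<ge> 1" using j by simp
    ultimately show ?thesis unfolding mult_iff by blast
  qed
  show ?thesis
  proof
    assume mult: "algebraic_multiplicity g s j"
    then obtain g' where j: "j \<ge> 1" and g': "g = P ^ j * g'" "\<not> P dvd g'" by (auto simp: mult_iff)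
    have "P dvd g" using j by (auto simp: g'(1) intro: dvd_mult2)
    hence "n \<noteq> 0" using n(2) P_D(8) dvd_unit_imp_unit by blast
    hence "P dvd (\<Prod>j=1..n. h j ^ j)" using n(3) \<open>P dvd g\<close> by simp
    then obtain j' where "P dvd h j'"
      using prime_elem_dvd_power[OF P_D(1)] by (auto simp: prime_elem_dvd_prod_iff[OF P_D(1)])
    hence root: "puiseux_root (h j') s" by (simp add: P_D(2))
    then obtain g'' where g'': "g = P ^ j' * g''" "\<not> P dvd g''"
      using root_imp[of j'] by (auto simp: mult_iff)
    have "j = j'" using power_decompose_unique[of P j g' j' g''] g' g'' P_D(7) by simp
    thus "puiseux_root (h j) s" using root by simp
  qed (rule root_imp)
qed

lemma puiseux_root_div_common_divisor:
  assumes F: "d * fbar \<noteq> 0" "d dvd deriv_y (d * fbar)" and root: "puiseux_root (d * fbar) s"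
  shows "puiseux_root fbar s"
proof -
  obtain P where P: "puiseux_prime P s" using puiseux_prime_exists[OF root F(1)] by blast
  note P_D = puiseux_primeD[OF P]
  have "P dvd fbar"
    by (rule prime_dvd_div_common_divisor[OF deriv_y_mult P_D(1,6) F(1) _ F(2)])
       (use root P_D(2) in blast)
  thus ?thesis by (simp add: P_D(2))
qed

lemma var_x_dvd_div_common_divisor:
  assumes "d * fbar \<noteq> 0" "d dvd deriv_x (d * fbar)" "var_x dvd d * fbar"
  shows "var_x dvd fbar"
proof (rule prime_dvd_div_common_divisor[OF deriv_x_mult prime_elem_var_x _ assms(1,3,2)])
  have "deriv_x var_x = 1"
    by (simp add: Rep_conv2_inject[symmetric] deriv_x.rep_eq var_x.rep_eq one_conv2.rep_eq)
  thus "\<not> var_x dvd deriv_x var_x" using prime_elem_var_x by simp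
qed

section \<open>The changes of variables of the algorithm\<close>

text \<open>
  The coefficient of $x^N$ in $F(x^n, x^m(a+y))$ is the sum of $c_{k,l} (a+y)^l$ over the exponents with
  $nk + ml = N$.  On this line $l$ determines $k$, so for the largest $l$ with $c_{k,l} \neq 0$ the coefficient
  of $y^l$ is $c_{k,l}$.
\<close>

lemma np_subst_nonzero:
  assumes n: "n > 0" and m: "m > 0" and F: "F \<noteq> 0"
  shows "np_subst n m a F \<noteq> 0"
proof
  assume 0: "np_subst n m a F = 0"
  define w where "w = fps_const a + (fps_X :: complex fps)"
  define c where "c k l = fps_nth (fps_nth (Rep_conv2 F) k) l" for k l
  obtain k0 l0 where kl0: "c k0 l0 \<noteq> 0"
    using F by (auto simp: Rep_conv2_inject[symmetric] zero_conv2.rep_eq fps_eq_iff c_def)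
  define N where "N = n * k0 + m * l0"
  define S where "S = {l. \<exists>k. n * k + m * l = N \<and> c k l \<noteq> 0}"
  have le_N: "k \<le> N \<and> l \<le> N" if "n * k + m * l = N" for k l
    using that n m mult_le_mono1[of 1 n k] mult_le_mono1[of 1 m l] by linarith
  have "S \<subseteq> {..N}" unfolding S_def using le_N by blast
  hence "finite S" by (rule finite_subset) simp
  moreover have "l0 \<in> S" using kl0 by (auto simp: S_def N_def)
  ultimately have L: "Max S \<in> S" "\<And>l. l \<in> S \<Longrightarrow> l \<le> Max S" by (auto intro: Max_in)
  define L where "L = Max S"
  obtain K where K: "n * K + m * L = N" "c K L \<noteq> 0" using L(1) by (auto simp: S_def L_def)
  have monomial: "fps_nth ((fps_X ^ n) ^ k * (fps_X ^ m * fps_const w) ^ l) N = (if n * k + m * l = N then w ^ l else 0)" for k l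
  proof -
    have "(fps_X ^ n) ^ k * (fps_X ^ m * fps_const w) ^ l = fps_X ^ (n * k + m * l) * fps_const (w ^ l)"
      by (simp add: power_mult_distrib power_mult[symmetric] power_add fps_const_power mult_ac)
    thus ?thesis by (simp only: fps_X_power_mult_nth) auto
  qed
  have w_top: "fps_nth (w ^ l) l = 1" for l
  proof (induction l)
    case (Suc l)
    have "fps_nth (w ^ Suc l) (Suc l) = a * fps_nth (w ^ l) (Suc l) + fps_nth (w ^ l) l"
      by (simp add: w_def distrib_right)
    thus ?case using Suc fps_nth_power_const_add_X_eq_0[of l "Suc l" a] by (simp add: w_def)
  qed (simp add: w_def)
  have "0 = fps_nth (fps_nth (Rep_conv2 (np_subst n m a F)) N) L"
    by (simp add: 0 zero_conv2.rep_eq)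
  also have "\<dots> = (\<Sum>k\<le>N. \<Sum>l\<le>N. c k l * fps_nth (if n * k + m * l = N then w ^ l else 0) L)"
    by (simp add: np_subst.rep_eq fps_subst2_def fps_sum_nth monomial c_def flip: w_def)
  also have "\<dots> = (\<Sum>k\<le>N. if k = K then (\<Sum>l\<le>N. if l = L then c K L else 0) else 0)"
  proof (rule sum.cong[OF refl])
    fix k
    have "c k l * fps_nth (if n * k + m * l = N then w ^ l else 0) L =
          (if k = K then if l = L then c K L else 0 else 0)" for l
    proof (cases "n * k + m * l = N \<and> c k l \<noteq> 0")
      case True
      hence "l \<le> L" using L(2)[of l] by (auto simp: S_def L_def)
      show ?thesis
      proof (cases "l = L")
        case True
        hence "k = K" using K(1) \<open>n * k + m * l = N \<and> c k l \<noteq> 0\<close> n by auto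
        thus ?thesis using True K(1) w_top by simp
      next
        case False
        hence "fps_nth (w ^ l) L = 0"
          using \<open>l \<le> L\<close> fps_nth_power_const_add_X_eq_0[of l L a] by (simp add: w_def)
        thus ?thesis using False by auto
      qed
    qed (use K in auto)
    thus "(\<Sum>l\<le>N. c k l * fps_nth (if n * k + m * l = N then w ^ l else 0) L) =
          (if k = K then (\<Sum>l\<le>N. if l = L then c K L else 0) else 0)"
      by simp
  qed
  also have "\<dots> = c K L" using le_N[OF K(1)] by simp
  finally show False using K(2) by simp
qed

lemma np_transform_decompose:
  assumes "F \<noteq> 0" "s \<noteq> 0" "puiseux_coeff s 0 = 0"
  obtains \<beta> where "np_subst (np_n s) (np_m s) (np_a s) F = var_x ^ \<beta> * np_transform s F"
    "\<not> var_x dvd np_transform s F"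
proof -
  define F' where "F' = np_subst (np_n s) (np_m s) (np_a s) F"
  have "F' \<noteq> 0"
    unfolding F'_def using puiseux_order_eq(3,4)[OF assms(2,3)] assms(1) by (intro np_subst_nonzero) auto
  then obtain e H where H: "F' = var_x ^ e * H" "\<not> var_x dvd H" using var_x_power_decompose by blast
  have "(GREATEST \<beta>. var_x ^ \<beta> dvd F') = e"
  proof (rule Greatest_equality)
    show "var_x ^ e dvd F'" by (simp add: H(1))
    fix \<beta> assume \<beta>: "var_x ^ \<beta> dvd F'"
    show "\<beta> \<le> e"
    proof (rule ccontr)
      assume "\<not> \<beta> \<le> e"
      hence "var_x ^ Suc e dvd F'" using \<beta> by (intro power_le_dvd[OF \<beta>]) simp
      hence "var_x ^ e * var_x dvd var_x ^ e * H" by (simp add: H(1) mult.commute)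
      thus False using H(2) var_x_nonzero by simp
    qed
  qed
  hence "np_transform s F = F' div var_x ^ e"
    unfolding np_transform_def Let_def F'_def by simp
  also have "\<dots> = H"
    unfolding H(1) using var_x_nonzero by (simp add: nonzero_mult_div_cancel_left)
  finally have "np_transform s F = H" .
  thus ?thesis using that[of e] H by (simp add: F'_def)
qed

text \<open>
  $T$ stands for $T(x^n) = x^m (a + t(x))$, expressed through a common denominator $N$ of
  the exponents of $t$.  The power of
  $x$ removed by the transform does not vanish at $t$.
\<close>

lemma puiseux_root_np_transform:
  assumes s: "s \<noteq> 0" "puiseux_coeff s 0 = 0" and t: "puiseux_denom N t" "puiseux_coeff t 0 = 0"
    and T: "puiseux_denom (N * np_n s) T"
      "puiseux_pullback (N * np_n s) T = fps_X ^ (N * np_m s) * (fps_const (np_a s) + puiseux_pullback N t)"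
    and F: "F \<noteq> 0"
  shows "puiseux_root (np_transform s F) t \<longleftrightarrow> puiseux_root F T"
proof -
  note pos = puiseux_order_eq(3,4)[OF s]
  have N: "N > 0" using t(1) by (simp add: puiseux_denom_def)
  have T0: "puiseux_coeff T 0 = 0"
    using arg_cong[OF T(2), of "\<lambda>u. fps_nth u 0"] N pos by (simp add: puiseux_pullback_nth_0)
  obtain \<beta> where \<beta>: "np_subst (np_n s) (np_m s) (np_a s) F = var_x ^ \<beta> * np_transform s F"
    using np_transform_decompose[OF F s] by blast
  have "puiseux_root (np_transform s F) t \<longleftrightarrow> puiseux_root (np_subst (np_n s) (np_m s) (np_a s) F) t"
    unfolding \<beta> using puiseux_root_power[of var_x \<beta> t] not_puiseux_root_var_x by (auto simp: puiseux_root_mult)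
  also have "\<dots> \<longleftrightarrow> puiseux_root F T"
    using N pos by (simp add: puiseux_root_iff[OF t] puiseux_root_iff[OF T(1) T0] T(2)
      fps_subst2_np_subst puiseux_pullback_nth_0 t(2))
  finally show ?thesis .
qed

lemma puiseux_root_np_transform_lift:
  assumes "s \<noteq> 0" "puiseux_coeff s 0 = 0" "puiseux_coeff t 0 = 0"
  obtains T where "puiseux_coeff T 0 = 0"
    "\<And>F. F \<noteq> 0 \<Longrightarrow> puiseux_root (np_transform s F) t \<longleftrightarrow> puiseux_root F T"
proof -
  note pos = puiseux_order_eq(3,4)[OF assms(1,2)]
  obtain N where N: "puiseux_denom N t" "N > 0" by (rule obtain_puiseux_denom)
  obtain T where T: "puiseux_denom (N * np_n s) T"
    "puiseux_pullback (N * np_n s) T = fps_X ^ (N * np_m s) * (fps_const (np_a s) + puiseux_pullback N t)"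
    using puiseux_pullback_surj[of "N * np_n s"] N(2) pos by (metis nat_0_less_mult_iff)
  have "puiseux_coeff T 0 = 0"
    using arg_cong[OF T(2), of "\<lambda>u. fps_nth u 0"] N pos by (simp add: puiseux_pullback_nth_0)
  thus ?thesis using that puiseux_root_np_transform[OF assms(1,2) N(1) assms(3) T] by blast
qed

lemma puiseux_root_np_next:
  assumes s: "s \<noteq> 0" "puiseux_coeff s 0 = 0" and F: "F \<noteq> 0"
  shows "puiseux_root (np_transform s F) (np_next s) \<longleftrightarrow> puiseux_root F s"
proof -
  note pos = puiseux_order_eq(3,4)[OF s]
  note coeff = puiseux_coeff_np_next[OF s]
  obtain N where N: "puiseux_denom N (np_next s)" "N > 0" by (rule obtain_puiseux_denom)
  have denom: "puiseux_denom (N * np_n s) s"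
    unfolding puiseux_denom_def
  proof (intro conjI allI impI)
    show "N * np_n s > 0" using N(2) pos by simp
    fix q assume q: "puiseux_coeff s q \<noteq> 0"
    have "\<exists>k::nat. q * of_nat (np_n s) - of_nat (np_m s) = of_nat k / of_nat N"
    proof (cases "q * of_nat (np_n s) = of_nat (np_m s)")
      case False
      hence "puiseux_coeff (np_next s) (q * of_nat (np_n s) - of_nat (np_m s)) \<noteq> 0"
        using q coeff(2)[of "q * of_nat (np_n s)"] pos by (auto split: if_splits)
      thus ?thesis using N(1) unfolding puiseux_denom_def by blast
    qed (auto intro: exI[of _ 0])
    then obtain k :: nat where "q * of_nat (np_n s) - of_nat (np_m s) = of_nat k / of_nat N" by blast
    hence "q = of_nat (k + np_m s * N) / of_nat (N * np_n s)"
      using N(2) pos by (simp add: field_simps)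
    thus "\<exists>k::nat. q = of_nat k / of_nat (N * np_n s)" by blast
  qed
  have "puiseux_pullback (N * np_n s) s = fps_X ^ (N * np_m s) * (fps_const (np_a s) + puiseux_pullback N (np_next s))"
  proof (rule fps_ext)
    fix j
    have "fps_nth (puiseux_pullback (N * np_n s) s) j = puiseux_coeff s ((of_nat j / of_nat N) / of_nat (np_n s))"
      by (simp add: puiseux_pullback_def)
    also have "\<dots> = (if j < N * np_m s then 0 else if j = N * np_m s then np_a s
                     else puiseux_coeff (np_next s) (of_nat (j - N * np_m s) / of_nat N))"
    proof -
      have "(of_nat j / of_nat N < (of_nat (np_m s) :: rat)) = (of_nat j < (of_nat (N * np_m s) :: rat))"
        "(of_nat j / of_nat N = (of_nat (np_m s) :: rat)) = (of_nat j = (of_nat (N * np_m s) :: rat))"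
        using N(2) by (simp_all add: field_simps)
      moreover have "of_nat j / of_nat N - of_nat (np_m s) = (of_nat (j - N * np_m s) / of_nat N :: rat)"
        if "\<not> j < N * np_m s"
        using N(2) that by (simp add: of_nat_diff field_simps)
      ultimately show ?thesis unfolding coeff(2) by (simp only: of_nat_less_iff of_nat_eq_iff) simp
    qed
    also have "\<dots> = fps_nth (fps_X ^ (N * np_m s) * (fps_const (np_a s) + puiseux_pullback N (np_next s))) j"
      using coeff(1) by (auto simp: fps_X_power_mult_nth puiseux_pullback_def)
    finally show "fps_nth (puiseux_pullback (N * np_n s) s) j =
      fps_nth (fps_X ^ (N * np_m s) * (fps_const (np_a s) + puiseux_pullback N (np_next s))) j" .
  qed
  thus ?thesis
    using puiseux_root_np_transform[OF s N(1) coeff(1) denom _ F] by blast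
qed

lemma np_series_coeff_0:
  assumes "puiseux_coeff s 0 = 0"
  shows "puiseux_coeff (np_series s i) 0 = 0"
  using assms by (cases i) (simp_all add: np_next.rep_eq)

context
  fixes s :: puiseux and i :: nat
  assumes s0: "puiseux_coeff s 0 = 0" and steps: "\<forall>t<i. np_series s t \<noteq> 0"
begin

lemma np_iter_nonzero:
  assumes "g \<noteq> 0" "i' \<le> i"
  shows "np_iter s g i' \<noteq> 0"
  using assms(2)
proof (induction i')
  case (Suc i')
  have "\<not> var_x dvd np_iter s g (Suc i')"
    using np_transform_decompose[of "np_iter s g i'" "np_series s i'"] Suc steps np_series_coeff_0[OF s0]
    by (metis Suc_le_lessD less_imp_le np_iter.simps(2))
  thus ?case by auto
qed (simp add: assms)

lemma var_x_not_dvd_np_iter: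
  assumes "g \<noteq> 0" "0 < i'" "i' \<le> i"
  shows "\<not> var_x dvd np_iter s g i'"
proof -
  obtain j where j: "i' = Suc j" using assms(2) by (cases i') auto
  thus ?thesis
    using np_transform_decompose[of "np_iter s g j" "np_series s j"] np_iter_nonzero[of g j] assms
      steps np_series_coeff_0[OF s0] by (metis Suc_le_lessD less_imp_le np_iter.simps(2))
qed

lemma puiseux_root_np_series:
  assumes "g \<noteq> 0" "i' \<le> i"
  shows "puiseux_root (np_iter s g i') (np_series s i') \<longleftrightarrow> puiseux_root g s"
  using assms(2)
proof (induction i')
  case (Suc i')
  thus ?case
    using puiseux_root_np_next[of "np_series s i'" "np_iter s g i'"] steps np_series_coeff_0[OF s0]
      np_iter_nonzero[OF assms(1), of i'] by simp
qed simp

lemma puiseux_root_np_iter_lift: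
  assumes "i' \<le> i" "puiseux_coeff t 0 = 0"
  shows "\<exists>T. \<forall>g. g \<noteq> 0 \<longrightarrow> (puiseux_root (np_iter s g i') t \<longleftrightarrow> puiseux_root g T)"
  using assms
proof (induction i' arbitrary: t)
  case (Suc i')
  obtain T' where T': "puiseux_coeff T' 0 = 0"
    "\<And>F. F \<noteq> 0 \<Longrightarrow> puiseux_root (np_transform (np_series s i') F) t \<longleftrightarrow> puiseux_root F T'"
    using puiseux_root_np_transform_lift[of "np_series s i'" t] Suc.prems steps np_series_coeff_0[OF s0]
    by (metis Suc_le_lessD)
  obtain T where T: "\<forall>g. g \<noteq> 0 \<longrightarrow> (puiseux_root (np_iter s g i') T' \<longleftrightarrow> puiseux_root g T)"
    using Suc.IH[of T'] Suc.prems T'(1) by auto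
  show ?case
    using T T'(2) np_iter_nonzero Suc.prems(1) by (intro exI[of _ T]) simp
qed auto

text \<open>
  Were the transform of a unit not a unit, it would have a Puiseux series, and its lift would be a series of
  the unit.
\<close>

lemma is_unit_np_iter_Suc:
  assumes "g \<noteq> 0" "Suc i' \<le> i" "is_unit (np_iter s g i')"
  shows "is_unit (np_iter s g (Suc i'))"
proof (rule ccontr)
  assume "\<not> is_unit (np_iter s g (Suc i'))"
  then obtain t where t: "puiseux_root (np_iter s g (Suc i')) t"
    using puiseux_root_exists var_x_not_dvd_np_iter[OF assms(1), of "Suc i'"] assms(2) by blast
  obtain T' where "puiseux_root (np_iter s g i') T'"
    using puiseux_root_np_transform_lift[of "np_series s i'" t] t puiseux_rootD[OF t] steps
      np_series_coeff_0[OF s0] np_iter_nonzero[OF assms(1), of i'] assms(2)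
    by (metis Suc_le_lessD less_imp_le np_iter.simps(2))
  thus False using assms(3) not_puiseux_root_unit by blast
qed

text \<open>
  The set $S^{(i)}$ is formed by discarding units at every step; by the previous lemma, only the last step
  matters.
\<close>

lemma np_iter_mem_np_set_iff:
  assumes "k \<in> {1..r}" "h j k \<noteq> 0"
  shows "np_iter s (h j k) i \<in> np_set s r h i \<longleftrightarrow> \<not> is_unit (np_iter s (h j k) i)"
proof
  show "np_iter s (h j k) i \<in> np_set s r h i \<Longrightarrow> \<not> is_unit (np_iter s (h j k) i)"
    by (cases i) auto
  have "np_iter s (h j k) i' \<in> np_set s r h i'" if "i' \<le> i" "\<not> is_unit (np_iter s (h j k) i')" for i'
    using that
  proof (induction i')
    case 0
    thus ?case using assms(1) by auto
  next
    case (Suc i')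
    thus ?case using is_unit_np_iter_Suc[OF assms(2)] by auto
  qed
  thus "\<not> is_unit (np_iter s (h j k) i) \<Longrightarrow> np_iter s (h j k) i \<in> np_set s r h i" by simp
qed

end

section \<open>Series with given multiplicity and surviving square-free factors\<close>

theorem proposition5p5:
  fixes r :: nat
    and f :: "nat \<Rightarrow> conv2"
    and F d fbar :: conv2
    and h :: "nat \<Rightarrow> nat \<Rightarrow> conv2"
    and s :: puiseux
    and i :: nat
  assumes F: "F = (\<Prod>k=1..r. f k)"
    and gcd: "is_gcd3 d F (deriv_y F) (deriv_x F)"
    and fbar: "fbar = F div d"
    and sqfree: "\<And>k. k \<in> {1..r} \<Longrightarrow> squarefree_factorization (f k) (\<lambda>j. h j k)"
    and root: "puiseux_root fbar s"
    and separated: "np_separated fbar s i"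
    and no_x: "i = 0 \<Longrightarrow> \<not> var_x dvd fbar"
  shows "\<forall>k\<in>{1..r}. \<forall>j. algebraic_multiplicity (f k) s j \<longleftrightarrow>
           np_iter s (h j k) i \<in> np_set s r h i"
proof (intro ballI allI)
  fix k j assume k: "k \<in> {1..r}"
  note h = squarefree_factorization_nonzero[OF sqfree]
  have s0: "puiseux_coeff s 0 = 0" using root by (rule puiseux_rootD)
  have steps: "\<forall>t<i. np_series s t \<noteq> 0" using separated by (simp add: np_separated_def)
  note iter = np_iter_nonzero[OF s0 steps] var_x_not_dvd_np_iter[OF s0 steps]
    puiseux_root_np_series[OF s0 steps] puiseux_root_np_iter_lift[OF s0 steps]
  have "F \<noteq> 0" unfolding F using h(1) by (subst prod_zero_iff) auto
  have d: "d dvd F" "d dvd deriv_y F" "d dvd deriv_x F" using gcd by (auto simp: is_gcd3_def)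
  have F_eq: "F = d * fbar" using d(1) by (simp add: fbar)
  have "h j k dvd f k" by (rule h(3)[OF k])
  also have "f k dvd F" unfolding F using k by (intro dvd_prodI) auto
  finally have h_dvd: "h j k dvd F" .
  have h_nz: "h j k \<noteq> 0" by (rule h(2)[OF k])
  have fbar_nz: "fbar \<noteq> 0" using \<open>F \<noteq> 0\<close> F_eq by auto
  have "\<not> is_unit (np_iter s (h j k) i) \<longleftrightarrow> puiseux_root (h j k) s"
  proof
    assume nonunit: "\<not> is_unit (np_iter s (h j k) i)"
    \<comment> \<open>The transforms are free of \<open>x\<close> by construction; before the first step it is \<open>fbar\<close> that is not divisible by \<open>x\<close>.\<close>
    have "\<not> var_x dvd np_iter s (h j k) i"
    proof (cases "i = 0")
      case True
      have "\<not> var_x dvd F"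
        using no_x[OF True] var_x_dvd_div_common_divisor[of d fbar] d(3) \<open>F \<noteq> 0\<close> F_eq by blast
      thus ?thesis using h_dvd dvd_trans True by auto
    qed (use iter(2)[OF h_nz] in simp)
    then obtain t where t: "puiseux_root (np_iter s (h j k) i) t"
      using puiseux_root_exists nonunit by blast
    obtain T where T: "\<And>g. g \<noteq> 0 \<Longrightarrow> puiseux_root (np_iter s g i) t \<longleftrightarrow> puiseux_root g T"
      using iter(4)[OF order.refl puiseux_rootD[OF t]] by blast
    have "puiseux_root (h j k) T" using T h_nz t by blast
    hence "puiseux_root F T" using h_dvd puiseux_root_dvd by blast
    hence "puiseux_root fbar T"
      using puiseux_root_div_common_divisor[of d fbar T] \<open>F \<noteq> 0\<close> d(2) unfolding F_eq by blast
    hence "puiseux_root (np_iter s fbar i) t" using T fbar_nz by blast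
    hence "puiseux_conjugate (np_series s i) t" using separated by (simp add: np_separated_def)
    hence "puiseux_root (np_iter s (h j k) i) (np_series s i)"
      using t puiseux_root_conjugate_iff by blast
    thus "puiseux_root (h j k) s" using iter(3)[OF h_nz order.refl] by blast
  next
    assume "puiseux_root (h j k) s"
    hence "puiseux_root (np_iter s (h j k) i) (np_series s i)" using iter(3)[OF h_nz order.refl] by blast
    thus "\<not> is_unit (np_iter s (h j k) i)" using not_puiseux_root_unit by blast
  qed
  moreover obtain P where "puiseux_prime P s" using puiseux_prime_exists[OF root fbar_nz] by blast
  ultimately show "algebraic_multiplicity (f k) s j \<longleftrightarrow> np_iter s (h j k) i \<in> np_set s r h i"
    using algebraic_multiplicity_iff_root_squarefree_factor[OF _ sqfree[OF k]]
      np_iter_mem_np_set_iff[OF s0 steps, of k r h j] k h_nz by blast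
qed

end
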